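(* Let $J$ and $I$ be $m$-regular Borel-fixed ideals in $S$ such that $\mathrm{Proj}(S/J)$ and $\mathrm{Proj}(S/I)$ share the same Hilbert polynomial $p(t)$. If $\prec$ is the degrevlex term order on $S$, then $J_m\prec\!\!\prec I_m$ if and only if $J_{m+1}\prec\!\!\prec I_{m+1}$.
   Context: $K$ is an infinite field, $S=K[x_0,\dots,x_n]$ with the standard grading; a term is a monic monomial. Degrevlex: for terms $\tau=x_0^{\alpha_0}\cdots x_n^{\alpha_n}$, $\sigma=x_0^{\beta_0}\cdots x_n^{\beta_n}$ of the same degree, $\tau\prec\sigma$ iff $\alpha_k>\beta_k$ where $k=\min\{i:\alpha_i\ne\beta_i\}$ (so $x_0\prec\dots\prec x_n$). $\mathrm{GL}_K(n+1)$ acts on $S$ by $g(f)=f(\sum_j g_{0j}x_j,\dots,\sum_j g_{nj}x_j)$; an ideal is Borel-fixed if it is fixed by all upper-triangular invertible matrices (hence it is monomial). A homogeneous ideal $I$ is $m$-regular if its Castelnuovo–Mumford regularity is at most $m$. $I_m$ denotes the degree $m$ component. For subspaces $V,V'$ of $S_t$ of the same finite dimension spanned by sets of terms $A,B$ respectively, $V\prec\!\!\prec V'$ means that there is a bijection $\omega:A\to B$ with $a\preceq\omega(a)$ for every $a\in A$. *)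

theory Defs
  imports
    "HOL-Analysis.Analysis"
    "HOL-Library.Poly_Mapping"
    "HOL-Library.Extended_Real"
    "HOL-Computational_Algebra.Polynomial"
begin

text \<open>
  The variables \<open>x\<^sub>0, \<dots>, x\<^sub>n\<close> are indexed by a finite linearly ordered type \<open>'n\<close> with \<open>n + 1\<close>
  elements, the order of the type being \<open>0 < 1 < \<dots> < n\<close>.  A term is identified with its
  exponent vector, and the whole type \<open>('n, 'k) mpoly\<close> is the ring \<open>S\<close>.
\<close>

type_synonym 'n pterm = "'n \<Rightarrow>\<^sub>0 nat"
type_synonym ('n, 'k) mpoly = "('n \<Rightarrow>\<^sub>0 nat) \<Rightarrow>\<^sub>0 'k"

definition Const :: "'k::comm_ring_1 \<Rightarrow> ('n, 'k) mpoly"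
  where "Const c = Poly_Mapping.single 0 c"

definition Var :: "'n \<Rightarrow> ('n, 'k::comm_ring_1) mpoly"
  where "Var i = Poly_Mapping.single (Poly_Mapping.single i 1) 1"

definition term_poly :: "'n pterm \<Rightarrow> ('n, 'k::comm_ring_1) mpoly"
  where "term_poly t = Poly_Mapping.single t 1"

definition scalar :: "'k::comm_ring_1 \<Rightarrow> ('n, 'k) mpoly \<Rightarrow> ('n, 'k) mpoly"
  where "scalar c f = Const c * f"

interpretation mpoly_vs: vector_space "scalar :: 'k::field \<Rightarrow> ('n, 'k) mpoly \<Rightarrow> ('n, 'k) mpoly"
proof
  fix a b :: 'k and f g :: "('n, 'k) mpoly"
  show "scalar a (f + g) = scalar a f + scalar a g"
    by (simp add: scalar_def distrib_left)
  show "scalar (a + b) f = scalar a f + scalar b f"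
    by (simp add: scalar_def Const_def single_add distrib_right)
  show "scalar a (scalar b f) = scalar (a * b) f"
    by (simp add: scalar_def Const_def mult_single flip: mult.assoc)
  show "scalar 1 f = f"
    by (simp add: scalar_def Const_def)
qed

interpretation mpoly_mod:
  module "(*) :: ('n, 'k::comm_ring_1) mpoly \<Rightarrow> ('n, 'k) mpoly \<Rightarrow> ('n, 'k) mpoly"
  by unfold_locales (simp_all add: algebra_simps)

definition is_ideal :: "('n, 'k::comm_ring_1) mpoly set \<Rightarrow> bool"
  where "is_ideal I \<longleftrightarrow> module.subspace (*) I"

definition term_degree :: "'n::finite pterm \<Rightarrow> nat"
  where "term_degree t = (\<Sum>i\<in>UNIV. Poly_Mapping.lookup t i)"

text \<open>Degrees are integers, as free modules may have generators in any integral degree.\<close>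

definition homogeneous :: "int \<Rightarrow> ('n::finite, 'k::comm_ring_1) mpoly \<Rightarrow> bool"
  where "homogeneous d f \<longleftrightarrow> (\<forall>t\<in>Poly_Mapping.keys f. int (term_degree t) = d)"

definition component :: "('n::finite, 'k::comm_ring_1) mpoly set \<Rightarrow> int \<Rightarrow> ('n, 'k) mpoly set"
  where "component I d = {f \<in> I. homogeneous d f}"

definition degrevlex :: "'n::{finite,linorder} pterm \<Rightarrow> 'n pterm \<Rightarrow> bool"
  where "degrevlex s t \<longleftrightarrow> term_degree s = term_degree t \<and>
    (\<exists>k. Poly_Mapping.lookup s k > Poly_Mapping.lookup t k \<and>
         (\<forall>i<k. Poly_Mapping.lookup s i = Poly_Mapping.lookup t i))"

text \<open>The relation \<open>V \<prec>\<prec> V'\<close>, for a strict order \<open>prec\<close> on terms.\<close>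

definition dominated ::
  "('n::finite pterm \<Rightarrow> 'n pterm \<Rightarrow> bool) \<Rightarrow> ('n, 'k::field) mpoly set \<Rightarrow> ('n, 'k) mpoly set \<Rightarrow> bool"
  where "dominated prec V V' \<longleftrightarrow>
    (\<exists>d A B. A \<subseteq> {t. term_degree t = d} \<and> B \<subseteq> {t. term_degree t = d} \<and>
       V = module.span scalar (term_poly ` A) \<and> V' = module.span scalar (term_poly ` B) \<and>
       (\<exists>\<omega>. bij_betw \<omega> A B \<and> (\<forall>a\<in>A. prec a (\<omega> a) \<or> a = \<omega> a)))"

subsection \<open>Borel-fixed ideals\<close>

definition gl_action :: "'k::comm_ring_1 ^ 'n::finite ^ 'n \<Rightarrow> ('n, 'k) mpoly \<Rightarrow> ('n, 'k) mpoly"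
  where "gl_action g f =
    (\<Sum>t\<in>Poly_Mapping.keys f. Const (Poly_Mapping.lookup f t) *
       (\<Prod>i\<in>UNIV. (\<Sum>j\<in>UNIV. Const (g $ i $ j) * Var j) ^ Poly_Mapping.lookup t i))"

definition upper_triangular :: "(('k::zero, 'n::{finite,linorder}) vec, 'n) vec \<Rightarrow> bool"
  where "upper_triangular g \<longleftrightarrow> (\<forall>i j. j < i \<longrightarrow> g $ i $ j = 0)"

definition borel_fixed :: "('n::{finite,linorder}, 'k::field) mpoly set \<Rightarrow> bool"
  where "borel_fixed I \<longleftrightarrow>
    (\<forall>g :: (('k, 'n) vec, 'n) vec. invertible g \<and> upper_triangular g \<longrightarrow> gl_action g ` I = I)"

subsection \<open>Castelnuovo--Mumford regularity\<close>

text \<open>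
  A graded free resolution \<open>\<dots> \<rightarrow> F\<^sub>1 \<rightarrow> F\<^sub>0 \<rightarrow> I \<rightarrow> 0\<close> by finitely generated free modules.
  The list \<open>b k\<close> contains the degrees of the basis elements of \<open>F\<^sub>k\<close>, so
  that \<open>F\<^sub>k\<close> is the direct sum of the \<open>S(-d)\<close> for \<open>d\<close> in \<open>b k\<close>; the \<open>j\<close>-th basis element of
  \<open>F\<^sub>0\<close> is sent to \<open>e j\<close>, and \<open>\<phi> k\<close> is the matrix of the map from \<open>F\<^bsub>k+1\<^esub>\<close> to \<open>F\<^sub>k\<close>.
  Elements of a free module of rank \<open>r\<close> are functions on \<open>nat\<close> of which only the values below
  \<open>r\<close> are relevant.
\<close>

definition mat_vec ::
  "nat \<Rightarrow> (nat \<Rightarrow> nat \<Rightarrow> 'a::comm_ring_1) \<Rightarrow> (nat \<Rightarrow> 'a) \<Rightarrow> nat \<Rightarrow> 'a"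
  where "mat_vec r M v i = (\<Sum>j<r. M i j * v j)"

definition graded_free_resolution ::
  "('n::finite, 'k::field) mpoly set \<Rightarrow> (nat \<Rightarrow> int list) \<Rightarrow> (nat \<Rightarrow> ('n, 'k) mpoly) \<Rightarrow>
   (nat \<Rightarrow> nat \<Rightarrow> nat \<Rightarrow> ('n, 'k) mpoly) \<Rightarrow> bool"
  where "graded_free_resolution I b e \<phi> \<longleftrightarrow>
    \<comment> \<open>the maps are homogeneous of degree 0\<close>
    (\<forall>j<length (b 0). homogeneous (b 0 ! j) (e j)) \<and>
    (\<forall>k. \<forall>i<length (b k). \<forall>j<length (b (Suc k)).
       homogeneous (b (Suc k) ! j - b k ! i) (\<phi> k i j)) \<and>
    \<comment> \<open>exactness at \<open>I\<close>, at \<open>F\<^sub>0\<close> and at \<open>F\<^bsub>k+1\<^esub>\<close>\<close>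
    I = range (\<lambda>v. \<Sum>j<length (b 0). e j * v j) \<and>
    (\<forall>v. (\<Sum>j<length (b 0). e j * v j) = 0 \<longleftrightarrow>
       (\<exists>w. \<forall>i<length (b 0). v i = mat_vec (length (b 1)) (\<phi> 0) w i)) \<and>
    (\<forall>k v. (\<forall>i<length (b k). mat_vec (length (b (Suc k))) (\<phi> k) v i = 0) \<longleftrightarrow>
       (\<exists>w. \<forall>i<length (b (Suc k)).
          v i = mat_vec (length (b (Suc (Suc k)))) (\<phi> (Suc k)) w i))"

text \<open>Minimality: each map \<open>F\<^bsub>k+1\<^esub> \<rightarrow> F\<^sub>k\<close> has its image in \<open>(x\<^sub>0, \<dots>, x\<^sub>n) F\<^sub>k\<close>.\<close>

definition minimal_graded_free_resolution ::
  "('n::finite, 'k::field) mpoly set \<Rightarrow> (nat \<Rightarrow> int list) \<Rightarrow> (nat \<Rightarrow> ('n, 'k) mpoly) \<Rightarrow>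
   (nat \<Rightarrow> nat \<Rightarrow> nat \<Rightarrow> ('n, 'k) mpoly) \<Rightarrow> bool"
  where "minimal_graded_free_resolution I b e \<phi> \<longleftrightarrow>
    graded_free_resolution I b e \<phi> \<and>
    (\<forall>k. \<forall>i<length (b k). \<forall>j<length (b (Suc k)). Poly_Mapping.lookup (\<phi> k i j) 0 = 0)"

text \<open>
  The supremum of the differences between the degrees of the generators of \<open>F\<^sub>k\<close> and \<open>k\<close>, for
  a minimal graded free resolution of \<open>I\<close>.  All such resolutions have the same degrees up to
  order, so for a homogeneous ideal the infimum ranges over a single value.
  The zero ideal has regularity \<open>-\<infinity>\<close>.
\<close>

definition cm_regularity :: "('n::finite, 'k::field) mpoly set \<Rightarrow> ereal"
  where "cm_regularity I =
    Inf {Sup {ereal (of_int (d - int k)) | k d. d \<in> set (b k)} | b e \<phi>.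
           minimal_graded_free_resolution I b e \<phi>}"

definition m_regular :: "int \<Rightarrow> ('n::finite, 'k::field) mpoly set \<Rightarrow> bool"
  where "m_regular m I \<longleftrightarrow> cm_regularity I \<le> ereal (of_int m)"

subsection \<open>Hilbert polynomial\<close>

text \<open>
  The dimension of the degree \<open>t\<close> part of \<open>S/I\<close>, for a homogeneous ideal \<open>I\<close>.  The Hilbert
  polynomial of \<open>Proj(S/I)\<close> is the polynomial agreeing with this function for large \<open>t\<close>.
\<close>

definition hilbert_function :: "('n::finite, 'k::field) mpoly set \<Rightarrow> nat \<Rightarrow> nat"
  where "hilbert_function I t =
    vector_space.dim scalar (component (UNIV :: ('n, 'k) mpoly set) (int t)) -
    vector_space.dim scalar (component I (int t))"

definition is_hilbert_polynomial :: "('n::finite, 'k::field) mpoly set \<Rightarrow> rat poly \<Rightarrow> bool"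
  where "is_hilbert_polynomial I p \<longleftrightarrow>
    (\<forall>\<^sub>F t in sequentially. poly p (of_nat t) = of_nat (hilbert_function I t))"

end

theory Submission
  imports Defs
begin

text \<open>
  Let \<open>mv t\<close> be the least variable dividing \<open>t\<close>. If \<open>I\<close> is Borel-fixed and \<open>m\<close>-regular, then for
  every \<open>u\<close> in \<open>I\<close> of degree greater than \<open>m\<close> also \<open>u / mv u\<close> is in \<open>I\<close>: otherwise some multiple of
  \<open>u / mv u\<close> yields a Koszul homology class of \<open>I\<close> in a degree excluded by regularity. In
  positive characteristic this is not a consequence of \<open>I\<close> being generated in degrees up to
  \<open>m\<close>. Hence the terms \<open>u\<close> of \<open>I\<close> in degree \<open>d + 1 > m\<close> with \<open>mv u = x\<^sub>j\<close> correspond to the terms \<open>t\<close>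
  in degree \<open>d\<close> with \<open>mv t \<ge> x\<^sub>j\<close>, so the numbers of terms with given least variable evolve
  by an invertible linear recursion in \<open>d\<close>, and ideals with equal Hilbert polynomials have
  the same such numbers in all degrees from \<open>m\<close> on. As \<open>mv\<close> is monotone for degrevlex, the
  terms of \<open>I\<^bsub>m+1\<^esub>\<close> that are at least \<open>s x\<^sub>j\<close>, where \<open>mv (s x\<^sub>j) = x\<^sub>j\<close>, are those with greater
  least variable together with the \<open>t x\<^sub>j\<close> for the terms \<open>t\<close> of \<open>I\<^sub>m\<close> that are at least \<open>s\<close>; so
  the counting conditions for domination in degrees \<open>m\<close> and \<open>m + 1\<close> are the same.
\<close>

declare mpoly_mod.scale_scale [simp del] \<comment> \<open>it loops with \<open>mult.assoc\<close>\<close>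

abbreviation "lookup \<equiv> Poly_Mapping.lookup"
abbreviation "keys \<equiv> Poly_Mapping.keys"
abbreviation "single \<equiv> Poly_Mapping.single"

section \<open>Coefficients of products with a term, a variable or a constant\<close>

definition var_term :: "'n \<Rightarrow> 'n pterm"
  where "var_term i = single i 1"

lemma lookup_var_term: "lookup (var_term i) j = (if i = j then 1 else 0)"
  by (simp add: var_term_def lookup_single when_def)

lemma Var_eq: "Var i = single (var_term i) 1"
  by (simp add: Var_def var_term_def)

lemma lookup_single_mult:
  fixes f :: "('n, 'k::comm_ring_1) mpoly"
  shows "lookup (single a c * f) (a + k) = c * lookup f k"
proof -
  have eq: "(a + k = a + q) = (k = q)" for q by simp
  show ?thesis
    by (simp add: lookup_mult lookup_single when_mult eq)
qed

lemma lookup_single_mult_eq_0: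
  fixes f :: "('n, 'k::comm_ring_1) mpoly"
  assumes "\<And>q. k \<noteq> a + q"
  shows "lookup (single a c * f) k = 0"
  using assms by (simp add: lookup_mult lookup_single when_mult)

lemma var_term_diff_add:
  fixes t :: "'n pterm"
  assumes "lookup t l \<noteq> 0"
  shows "t - var_term l + var_term l = t" "var_term l + (t - var_term l) = t"
  using assms
  by (auto intro!: poly_mapping_eqI simp: lookup_add lookup_minus lookup_var_term)

lemma lookup_Var_mult:
  fixes f :: "('n, 'k::comm_ring_1) mpoly"
  shows "lookup (Var l * f) t = (if lookup t l = 0 then 0 else lookup f (t - var_term l))"
proof (cases "lookup t l = 0")
  case True
  have "t \<noteq> var_term l + q" for q
    using True by (auto simp: lookup_add lookup_var_term)
  then show ?thesis using True by (simp add: Var_eq lookup_single_mult_eq_0)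
next
  case False
  then show ?thesis
    using lookup_single_mult[of "var_term l" 1 f "t - var_term l"]
    by (simp add: Var_eq var_term_diff_add)
qed

lemma lookup_minus_one_power_mult:
  fixes f :: "('n, 'k::comm_ring_1) mpoly"
  shows "lookup ((-1) ^ k * f) t = (-1) ^ k * lookup f t"
  by (induction k) auto

lemma lookup_Const_mult:
  fixes f :: "('n, 'k::comm_ring_1) mpoly"
  shows "lookup (Const c * f) t = c * lookup f t"
  using lookup_single_mult[of 0 c f t] by (simp add: Const_def)

subsection \<open>Homogeneous components\<close>

lemma homogeneous_0 [simp]: "homogeneous d 0"
  by (simp add: homogeneous_def)

lemma homogeneous_add: "homogeneous d f \<Longrightarrow> homogeneous d g \<Longrightarrow> homogeneous d (f + g)"
  using keys_add[of f g] unfolding homogeneous_def by blast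

lemma homogeneous_sum: "(\<And>i. i \<in> A \<Longrightarrow> homogeneous d (f i)) \<Longrightarrow> homogeneous d (sum f A)"
  by (induction A rule: infinite_finite_induct) (auto intro: homogeneous_add)

lemma homogeneous_minus_one_power_mult:
  "homogeneous d f \<Longrightarrow> homogeneous d ((-1) ^ k * f)"
  by (auto simp: homogeneous_def in_keys_iff lookup_minus_one_power_mult)

lemma term_degree_add: "term_degree (s + t) = term_degree s + term_degree t"
  by (simp add: term_degree_def lookup_add sum.distrib)

lemma term_degree_0 [simp]: "term_degree 0 = 0"
  by (simp add: term_degree_def)

lemma term_degree_var_term [simp]: "term_degree (var_term i) = 1"
  by (simp add: term_degree_def lookup_var_term)

lemma homogeneous_mult:
  assumes "homogeneous d f" and "homogeneous e g"
  shows "homogeneous (d + e) (f * g)"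
  using assms keys_mult[of f g] unfolding homogeneous_def
  by (fastforce simp: term_degree_add)

lemma homogeneous_Var: "homogeneous 1 (Var i)"
  by (simp add: homogeneous_def Var_eq)

text \<open>The homogeneous part of degree \<open>d\<close>, used to replace arbitrary lifts along
  graded maps by homogeneous ones; it vanishes for negative \<open>d\<close>.\<close>

lift_definition hcomp :: "int \<Rightarrow> ('n::finite, 'k::zero) mpoly \<Rightarrow> ('n, 'k) mpoly"
  is "\<lambda>d f t. if int (term_degree t) = d then f t else 0"
  by (rule finite_subset) auto

lemma homogeneous_hcomp: "homogeneous d (hcomp d f)"
  by (auto simp: homogeneous_def in_keys_iff hcomp.rep_eq split: if_splits)

lemma hcomp_homogeneous: "homogeneous d f \<Longrightarrow> hcomp d f = f"
  by (auto intro!: poly_mapping_eqI simp: homogeneous_def hcomp.rep_eq in_keys_iff)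

lemma hcomp_sum: "hcomp d (sum f A) = (\<Sum>i\<in>A. hcomp d (f i))"
  by (rule poly_mapping_eqI) (simp add: hcomp.rep_eq lookup_sum)

text \<open>All terms of \<open>p\<close> have degree \<open>e\<close>, so only the terms of
  \<open>f\<close> of degree \<open>d - e\<close> contribute in degree \<open>d\<close>.\<close>

lemma hcomp_mult:
  fixes p f :: "('n::finite, 'k::comm_ring_1) mpoly"
  assumes "homogeneous e p"
  shows "hcomp d (p * f) = p * hcomp (d - e) f"
proof -
  have hom: "homogeneous d (p * hcomp (d - e) f)"
    using homogeneous_mult[OF assms homogeneous_hcomp, of "d - e" f] by simp
  have "lookup (hcomp d (p * (f - hcomp (d - e) f))) t = 0" for t
  proof (cases "int (term_degree t) = d")
    case True
    have "t \<notin> keys (p * (f - hcomp (d - e) f))"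
    proof
      assume "t \<in> keys (p * (f - hcomp (d - e) f))"
      then obtain a b where ab: "t = a + b" "a \<in> keys p" "b \<in> keys (f - hcomp (d - e) f)"
        using keys_mult by blast
      then have "int (term_degree b) = d - e"
        using assms True by (auto simp: homogeneous_def term_degree_add)
      then show False
        using ab(3) by (simp add: in_keys_iff lookup_minus hcomp.rep_eq)
    qed
    then show ?thesis by (simp add: hcomp.rep_eq in_keys_iff)
  qed (simp add: hcomp.rep_eq)
  then have zero: "hcomp d (p * (f - hcomp (d - e) f)) = 0"
    by (intro poly_mapping_eqI) simp
  have "hcomp d (p * f) = hcomp d (p * (f - hcomp (d - e) f)) + hcomp d (p * hcomp (d - e) f)"
    by (rule poly_mapping_eqI) (simp add: hcomp.rep_eq lookup_add lookup_minus algebra_simps)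
  then show ?thesis using zero hom by (simp add: hcomp_homogeneous)
qed

subsection \<open>The Koszul complex\<close>

text \<open>The Koszul differential. A chain \<open>z\<close> stores the coefficient
  \<open>z F\<close> of the wedge of the \<open>e\<^sub>i\<close>, \<open>i \<in> F\<close>, in
  increasing order; the sum collects what the sets \<open>insert l G\<close> contribute to
  \<open>G\<close>.\<close>

definition bd :: "('n::{finite,linorder} set \<Rightarrow> ('n, 'k::comm_ring_1) mpoly) \<Rightarrow> 'n set \<Rightarrow> ('n, 'k) mpoly"
  where "bd z G = (\<Sum>l\<in>-G. (-1) ^ card {i\<in>G. i < l} * (Var l * z (insert l G)))"

lemma lookup_bd:
  "lookup (bd z G) t = (\<Sum>l\<in>-G. if lookup t l = 0 then 0
     else (-1) ^ card {i\<in>G. i < l} * lookup (z (insert l G)) (t - var_term l))"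
  unfolding bd_def lookup_sum
  by (intro sum.cong) (auto simp: lookup_minus_one_power_mult lookup_Var_mult)

lemma bd_diff: "bd (\<lambda>F. y F - z F) G = bd y G - bd z G"
  by (simp add: bd_def algebra_simps sum_subtractf)

lemma bd_mult: "bd (\<lambda>F. p * z F) G = p * bd z G"
  by (simp add: bd_def sum_distrib_left mult.left_commute)

lemma bd_sum: "bd (\<lambda>F. \<Sum>j\<in>A. z j F) G = (\<Sum>j\<in>A. bd (z j) G)"
  by (simp add: bd_def sum_distrib_left sum.swap[of _ A])

text \<open>The Koszul differential is linear over the polynomial ring, so it commutes with the maps
  of a resolution.\<close>

lemma bd_mat_vec:
  "bd (\<lambda>F. mat_vec r M (\<lambda>j. y j F) i) G = mat_vec r M (\<lambda>j. bd (y j) G) i"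
  by (simp add: mat_vec_def bd_sum bd_mult)

lemma bd_eq_0:
  assumes "\<And>l. l \<notin> G \<Longrightarrow> z (insert l G) = 0"
  shows "bd z G = 0"
  unfolding bd_def using assms by (intro sum.neutral) auto

lemma card_less_insert:
  fixes G :: "'n::{finite,linorder} set"
  assumes "m \<notin> G"
  shows "card {i \<in> insert m G. i < l} = (if m < l then Suc (card {i\<in>G. i < l}) else card {i\<in>G. i < l})"
proof (cases "m < l")
  case True
  then have "{i \<in> insert m G. i < l} = insert m {i\<in>G. i < l}" by auto
  then show ?thesis using True assms by simp
next
  case False
  then have "{i \<in> insert m G. i < l} = {i\<in>G. i < l}" by auto
  then show ?thesis using False by simp
qed

text \<open>Removing \<open>l\<close> and \<open>m\<close> in either order gives the same monomial
  with opposite signs, since the smaller index shifts the position of the larger one.\<close>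

lemma bd_bd: "bd (bd z) G = 0"
proof -
  define f where "f l m = (-1) ^ card {i\<in>G. i < l} * (Var l *
     ((-1) ^ card {i\<in>insert l G. i < m} * (Var m * z (insert m (insert l G)))))" for l m
  have anti: "f l m + f m l = 0" if "l \<notin> G" "m \<notin> G" "l < m" for l m
    using that card_less_insert[of l G m] card_less_insert[of m G l]
    by (simp add: f_def insert_commute algebra_simps del: insert_iff)
  let ?A = "{(l, m). l \<in> -G \<and> m \<in> -G \<and> l < m}"
  let ?B = "{(l, m). l \<in> -G \<and> m \<in> -G \<and> m < l}"
  have "bd (bd z) G = (\<Sum>l\<in>-G. \<Sum>m\<in>-(insert l G). f l m)"
    by (simp add: bd_def f_def sum_distrib_left)
  also have "\<dots> = (\<Sum>(l, m)\<in>(SIGMA l:-G. -(insert l G)). f l m)"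
    by (subst sum.Sigma) auto
  also have "(SIGMA l:-G. -(insert l G)) = ?A \<union> ?B"
    by (auto simp: neq_iff)
  also have "(\<Sum>(l, m)\<in>?A \<union> ?B. f l m) = (\<Sum>(l, m)\<in>?A. f l m) + (\<Sum>(l, m)\<in>?B. f l m)"
    by (rule sum.union_disjoint) (auto intro: finite_subset[OF subset_UNIV])
  also have "(\<Sum>(l, m)\<in>?B. f l m) = (\<Sum>(l, m)\<in>?A. f m l)"
    by (rule sum.reindex_bij_witness[of _ prod.swap prod.swap]) auto
  also have "(\<Sum>(l, m)\<in>?A. f l m) + (\<Sum>(l, m)\<in>?A. f m l) = (\<Sum>(l, m)\<in>?A. f l m + f m l)"
    by (simp add: sum.distrib case_prod_beta)
  also have "\<dots> = 0"
    by (rule sum.neutral) (use anti in auto)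
  finally show ?thesis .
qed

lemma homogeneous_bd:
  assumes "\<And>F. homogeneous d (z F)"
  shows "homogeneous (d + 1) (bd z G)"
  unfolding bd_def
  using homogeneous_mult[OF homogeneous_Var assms]
  by (intro homogeneous_sum homogeneous_minus_one_power_mult) (simp add: add.commute)

text \<open>
  The Koszul complex splits by multidegrees, the basis element \<open>t e\<^sub>F\<close> having multidegree
  \<open>t + \<Sum>\<^bsub>i\<in>F\<^esub> e\<^sub>i\<close>.  In a multidegree with least variable \<open>x\<^sub>j\<close>, wedging with \<open>e\<^sub>j\<close> and dividing
  by \<open>x\<^sub>j\<close> is a contracting homotopy.
\<close>

lemma koszul_exact:
  fixes z :: "'n::{finite,linorder} set \<Rightarrow> ('n, 'k::comm_ring_1) mpoly"
  assumes cycle: "\<And>G. bd z G = 0" and const: "lookup (z {}) 0 = 0"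
  shows "\<exists>w. \<forall>G. z G = bd w G"
proof -
  \<comment> \<open>The contracting homotopy on coefficients, \<open>Min (keys t \<union> F)\<close>
    being the least variable of the multidegree of \<open>t e\<^sub>F\<close>. If the multidegree is
    0, then \<open>F\<close> is empty and the value is 0 whatever \<open>Min {}\<close> is.\<close>
  define c where "c F t = (if Min (keys t \<union> F) \<in> F then
     lookup (z (F - {Min (keys t \<union> F)})) (t + var_term (Min (keys t \<union> F))) else 0)"
    for F and t :: "'n pterm"
  have fin: "finite {t. c F t \<noteq> 0}" for F
  proof (rule finite_subset)
    show "{t. c F t \<noteq> 0} \<subseteq> (\<Union>j\<in>F. (\<lambda>t. t + var_term j) -` keys (z (F - {j})))"
      by (auto simp: c_def in_keys_iff split: if_splits)
    show "finite (\<Union>j\<in>F. (\<lambda>t. t + var_term j) -` keys (z (F - {j})))"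
      by (auto intro!: finite_vimageI simp: inj_def)
  qed
  define w where "w F = Abs_poly_mapping (c F)" for F
  have w: "lookup (w F) t = c F t" for F t
    using fin[of F] by (simp add: w_def)
  have "z G = bd w G" for G
  proof (rule poly_mapping_eqI)
    fix t
    show "lookup (z G) t = lookup (bd w G) t"
    proof (cases "keys t \<union> G = {}")
      \<comment> \<open>In multidegree 0 there is no variable to contract with; only here is
        \<open>const\<close> used.\<close>
      case True
      then have "G = {}" "t = 0"
        by auto
      then show ?thesis using const by (simp add: lookup_bd)
    next
      case False
      define j where "j = Min (keys t \<union> G)"
      have j: "j \<in> keys t \<union> G" and j_le: "\<And>l. l \<in> keys t \<union> G \<Longrightarrow> j \<le> l"
        using False unfolding j_def by (intro Min_in) auto
      have none: "{i \<in> H. i < j} = {}" if "H \<subseteq> G" for H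
        using j_le that by force
      \<comment> \<open>Moving \<open>x\<^sub>l\<close> from the coefficient into the wedge
        preserves the multidegree, so all summands of the boundary refer to the same
        \<open>j\<close>.\<close>
      have supp: "keys (t - var_term l) \<union> insert l G = keys t \<union> G"
        if "lookup t l \<noteq> 0" for l
        using that by (auto simp: in_keys_iff lookup_minus lookup_var_term split: if_splits)
      have c: "c (insert l G) (t - var_term l) = (if j \<in> insert l G then
          lookup (z (insert l G - {j})) (t - var_term l + var_term j) else 0)"
        if "lookup t l \<noteq> 0" for l
        unfolding c_def supp[OF that] j_def ..
      have bdw: "lookup (bd w G) t = (\<Sum>l\<in>-G. if lookup t l = 0 then 0
          else if j \<in> insert l G then (-1) ^ card {i\<in>G. i < l} *
            lookup (z (insert l G - {j})) (t - var_term l + var_term j) else 0)"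
        unfolding lookup_bd by (intro sum.cong) (auto simp: w c)
      show ?thesis
      proof (cases "j \<in> G")
        case False
        then have "lookup t j \<noteq> 0" using j by (simp add: in_keys_iff)
        \<comment> \<open>The homotopy vanishes on wedges without \<open>e\<^sub>j\<close>, so only
          \<open>l = j\<close> remains; its sign is positive as nothing in \<open>G\<close> lies
          below \<open>j\<close>.\<close>
        have "lookup (bd w G) t = (\<Sum>l\<in>-G. if l = j then lookup (z G) t else 0)"
          unfolding bdw
        proof (intro sum.cong refl)
          fix l assume "l \<in> -G"
          then show "(if lookup t l = 0 then 0
              else if j \<in> insert l G then (-1) ^ card {i\<in>G. i < l} *
                lookup (z (insert l G - {j})) (t - var_term l + var_term j) else 0) =
              (if l = j then lookup (z G) t else 0)"
            using False \<open>lookup t j \<noteq> 0\<close> by (auto simp: none[OF subset_refl] var_term_diff_add)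
        qed
        also have "\<dots> = lookup (z G) t" using False by simp
        finally show ?thesis by simp
      next
        case True
        \<comment> \<open>In the cycle condition at \<open>G - {j}\<close> the summand
          \<open>l = j\<close> is the wanted coefficient. The others are those of
          \<open>bd w G\<close> with opposite sign, because \<open>j < l\<close> is counted for
          \<open>G\<close> but not for \<open>G - {j}\<close>.\<close>
        have "0 = lookup (bd z (G - {j})) (t + var_term j)"
          by (simp add: cycle)
        also have "\<dots> = (\<Sum>l\<in>insert j (-G). if lookup (t + var_term j) l = 0 then 0
            else (-1) ^ card {i\<in>G - {j}. i < l} *
              lookup (z (insert l (G - {j}))) (t + var_term j - var_term l))"
          unfolding lookup_bd using True by (intro sum.cong) auto
        also have "\<dots> = lookup (z G) t + (\<Sum>l\<in>-G. if lookup (t + var_term j) l = 0 then 0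
            else (-1) ^ card {i\<in>G - {j}. i < l} *
              lookup (z (insert l (G - {j}))) (t + var_term j - var_term l))"
          using True
          by (simp add: none[OF Diff_subset] lookup_add lookup_var_term insert_absorb del: Diff_iff)
        also have "(\<Sum>l\<in>-G. if lookup (t + var_term j) l = 0 then 0
            else (-1) ^ card {i\<in>G - {j}. i < l} *
              lookup (z (insert l (G - {j}))) (t + var_term j - var_term l)) = - lookup (bd w G) t"
          unfolding bdw sum_negf[symmetric]
        proof (intro sum.cong refl)
          fix l assume l: "l \<in> -G"
          then have lj: "l \<noteq> j" using True by auto
          have lt: "lookup (t + var_term j) l = lookup t l"
            using lj by (simp add: lookup_add lookup_var_term)
          show "(if lookup (t + var_term j) l = 0 then 0
            else (-1) ^ card {i\<in>G - {j}. i < l} *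
              lookup (z (insert l (G - {j}))) (t + var_term j - var_term l)) =
            - (if lookup t l = 0 then 0
              else if j \<in> insert l G then (-1) ^ card {i\<in>G. i < l} *
                lookup (z (insert l G - {j})) (t - var_term l + var_term j) else 0)"
          proof (cases "lookup t l = 0")
            case False
            then have "j < l" using j_le[of l] lj by (simp add: in_keys_iff)
            then have "card {i\<in>G. i < l} = Suc (card {i\<in>G - {j}. i < l})"
              using card_less_insert[of j "G - {j}" l] True by (simp add: insert_absorb)
            moreover have "insert l (G - {j}) = insert l G - {j}" using lj by auto
            moreover have "t + var_term j - var_term l = t - var_term l + var_term j"
              using False
              by (auto intro!: poly_mapping_eqI simp: lookup_add lookup_minus lookup_var_term)
            ultimately show ?thesis
              using False True lt by simp
          qed (simp add: lt)
        qed
        finally show ?thesis by simp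
      qed
    qed
  qed
  then show ?thesis by blast
qed

subsection \<open>Koszul homology and regularity\<close>

lemma mat_vec_diff: "mat_vec r M (\<lambda>j. v j - w j) i = mat_vec r M v i - mat_vec r M w i"
  by (simp add: mat_vec_def algebra_simps sum_subtractf)

lemma mat_vec_0: "(\<And>j. j < r \<Longrightarrow> v j = 0) \<Longrightarrow> mat_vec r M v i = 0"
  by (simp add: mat_vec_def)

lemma lookup_mult_0:
  fixes f g :: "('n, 'k::comm_ring_1) mpoly"
  assumes "lookup f 0 = 0"
  shows "lookup (f * g) 0 = 0"
proof -
  have "0 \<notin> keys (f * g)"
  proof
    assume "0 \<in> keys (f * g)"
    then obtain a b where ab: "0 = a + b" "a \<in> keys f"
      using keys_mult[of f g] by blast
    have "lookup a i = 0" for i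
      using arg_cong[OF ab(1), of "\<lambda>t. lookup t i"] by (simp add: lookup_add)
    then have "a = 0" by (intro poly_mapping_eqI) simp
    then show False using ab(2) assms by (simp add: in_keys_iff)
  qed
  then show ?thesis by (simp add: in_keys_iff)
qed

lemma homogeneous_lookup_0: "homogeneous d f \<Longrightarrow> d \<noteq> 0 \<Longrightarrow> lookup f 0 = 0"
  by (force simp: homogeneous_def in_keys_iff)

text \<open>The degrees of the entries say that \<open>M\<close> is a graded map of degree 0, so it
  respects homogeneous parts.\<close>

lemma hcomp_mat_vec:
  assumes "\<And>j. j < r \<Longrightarrow> homogeneous (c j - e) (M i j)"
  shows "hcomp (d - e) (mat_vec r M v i) = mat_vec r M (\<lambda>j. hcomp (d - c j) (v j)) i"
  unfolding mat_vec_def hcomp_sum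
proof (intro sum.cong refl)
  fix j assume "j \<in> {..<r}"
  then have "hcomp (d - e) (M i j * v j) = M i j * hcomp (d - e - (c j - e)) (v j)"
    by (intro hcomp_mult assms) simp
  also have "d - e - (c j - e) = d - c j" by simp
  finally show "hcomp (d - e) (M i j * v j) = M i j * hcomp (d - c j) (v j)" .
qed

text \<open>
  A chain \<open>z\<close> of Koszul degree \<open>r\<close> with coefficients in \<open>F\<^sub>l\<close>, the coefficients being indexed by
  the basis of \<open>F\<^sub>l\<close>, whose boundary comes from \<open>F\<^bsub>l+1\<^esub>\<close>.  The boundary is lifted repeatedly along
  the resolution until it is a chain of Koszul degree 0 in \<open>F\<^bsub>l+r\<^esub>\<close>, which is a boundary for reasons
  of degree; \<open>D\<close> is the total degree, each \<open>e\<^sub>j\<close> having degree 1.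
\<close>

lemma koszul_chase:
  fixes b :: "nat \<Rightarrow> int list" and \<phi> :: "nat \<Rightarrow> nat \<Rightarrow> nat \<Rightarrow> ('n::{finite,linorder}, 'k::field) mpoly"
  assumes res: "minimal_graded_free_resolution I b e \<phi>"
    and "\<And>F i. i < length (b l) \<Longrightarrow> card F \<noteq> r \<Longrightarrow> z i F = 0"
    and "\<And>F i. i < length (b l) \<Longrightarrow> homogeneous (D - int r - b l ! i) (z i F)"
    and "\<And>G. \<exists>v. \<forall>i<length (b l). bd (z i) G = mat_vec (length (b (Suc l))) (\<phi> l) v i"
    and "\<And>d. d \<in> set (b (l + r)) \<Longrightarrow> d < D"
  shows "\<exists>w y. \<forall>F. \<forall>i<length (b l).
    z i F = bd (w i) F + mat_vec (length (b (Suc l))) (\<phi> l) (\<lambda>j. y j F) i"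
  using assms(2-)
proof (induction r arbitrary: l z)
  case 0
  \<comment> \<open>A chain of Koszul degree 0 is a cycle, and its coefficient has the positive
    degree \<open>D - b l ! i\<close>, hence no constant term.\<close>
  have "\<exists>w. \<forall>F. z i F = bd w F" if i: "i < length (b l)" for i
  proof (rule koszul_exact)
    show "bd (z i) G = 0" for G
      by (rule bd_eq_0) (use i 0(1) in auto)
    have "b l ! i < D" using 0(4) i by simp
    then show "lookup (z i {}) 0 = 0"
      using 0(2)[OF i, of "{}"] by (auto intro: homogeneous_lookup_0)
  qed
  then obtain w where w: "\<forall>i<length (b l). \<forall>F. z i F = bd (w i) F" by metis
  show ?case
    by (intro exI[of _ w] exI[of _ "\<lambda>_ _. 0"]) (use w in \<open>simp add: mat_vec_0\<close>)
next
  case (Suc r)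
  let ?mv = "\<lambda>l. mat_vec (length (b (Suc l))) (\<phi> l)"
  have hom\<phi>: "homogeneous (b (Suc l) ! j - b l ! i) (\<phi> l i j)"
    if "i < length (b l)" "j < length (b (Suc l))" for i j
    using res that by (simp add: minimal_graded_free_resolution_def graded_free_resolution_def)
  have exact: "(\<forall>i<length (b l). ?mv l v i = 0) \<longleftrightarrow>
      (\<exists>w. \<forall>i<length (b (Suc l)). v i = ?mv (Suc l) w i)" for v
    using res by (simp add: minimal_graded_free_resolution_def graded_free_resolution_def)
  have min: "lookup (\<phi> l i j) 0 = 0" if "i < length (b l)" "j < length (b (Suc l))" for i j
    using res that by (simp add: minimal_graded_free_resolution_def)
  obtain v where v: "\<And>G i. i < length (b l) \<Longrightarrow> bd (z i) G = ?mv l (v G) i"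
    using Suc.prems(3) by metis
  \<comment> \<open>The lift \<open>v\<close> is cut down to Koszul degree \<open>r\<close> and to
    the right internal degree. It still lifts \<open>bd (z i)\<close>, which lives only
    there.\<close>
  define z' where "z' j G = (if card G = r then hcomp (D - int r - b (Suc l) ! j) (v G j) else 0)"
    for j G
  have bd_z: "bd (z i) G = ?mv l (\<lambda>j. z' j G) i" if i: "i < length (b l)" for i G
  proof (cases "card G = r")
    case True
    have "homogeneous (D - int r - b l ! i) (bd (z i) G)"
      using homogeneous_bd[OF Suc.prems(2)[OF i]] by (simp add: algebra_simps)
    then have "bd (z i) G = hcomp (D - int r - b l ! i) (?mv l (v G) i)"
      using v[OF i] by (simp add: hcomp_homogeneous)
    also have "\<dots> = ?mv l (\<lambda>j. z' j G) i"
      using True by (subst hcomp_mat_vec[where c = "\<lambda>j. b (Suc l) ! j"])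
        (auto simp: z'_def intro: hom\<phi> i)
    finally show ?thesis .
  next
    case False
    then have "bd (z i) G = 0"
      by (intro bd_eq_0 Suc.prems(1)[OF i]) simp
    then show ?thesis using False by (simp add: z'_def mat_vec_0)
  qed
  have "\<exists>w y. \<forall>F. \<forall>i<length (b (Suc l)). z' i F = bd (w i) F + ?mv (Suc l) (\<lambda>j. y j F) i"
  proof (rule Suc.IH)
    show "z' i F = 0" if "card F \<noteq> r" for i F
      using that by (simp add: z'_def)
    show "homogeneous (D - int r - b (Suc l) ! i) (z' i F)" for i F
      by (simp add: z'_def homogeneous_hcomp)
    show "d < D" if "d \<in> set (b (Suc l + r))" for d
      using Suc.prems(4) that by simp
    fix G
    \<comment> \<open>\<open>bd z'\<close> maps to \<open>bd (bd z) = 0\<close>, so by exactness it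
      comes from the next free module, as the induction hypothesis demands.\<close>
    have "?mv l (\<lambda>j. bd (z' j) G) i = 0" if i: "i < length (b l)" for i
    proof -
      have "?mv l (\<lambda>j. bd (z' j) G) i = bd (\<lambda>F. ?mv l (\<lambda>j. z' j F) i) G"
        by (simp add: bd_mat_vec)
      also have "\<dots> = bd (bd (z i)) G" using bd_z[OF i] by presburger
      finally show ?thesis by (simp add: bd_bd)
    qed
    then show "\<exists>v. \<forall>i<length (b (Suc l)). bd (z' i) G = ?mv (Suc l) v i"
      using exact[of "\<lambda>j. bd (z' j) G"] by blast
  qed
  then obtain w' y' where "\<forall>F. \<forall>j<length (b (Suc l)).
      z' j F = bd (w' j) F + ?mv (Suc l) (\<lambda>m. y' m F) j"
    by (elim exE) (rule that)
  then have z': "z' j F = bd (w' j) F + ?mv (Suc l) (\<lambda>m. y' m F) j"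
    if "j < length (b (Suc l))" for F j
    using that by blast
  \<comment> \<open>Correcting \<open>z\<close> by the image of \<open>w'\<close> gives a cycle:
    \<open>z'\<close> and \<open>bd w'\<close> differ by an image under
    \<open>\<phi> (Suc l)\<close>, which \<open>\<phi> l\<close> kills.\<close>
  have "\<exists>w. \<forall>F. z i F - ?mv l (\<lambda>j. w' j F) i = bd w F" if i: "i < length (b l)" for i
  proof (rule koszul_exact)
    fix G
    have "bd (z i) G = ?mv l (\<lambda>j. bd (w' j) G + (z' j G - bd (w' j) G)) i"
      using bd_z[OF i] by simp
    also have "\<dots> = ?mv l (\<lambda>j. bd (w' j) G) i + ?mv l (\<lambda>j. z' j G - bd (w' j) G) i"
      by (simp add: mat_vec_diff)
    also have "?mv l (\<lambda>j. z' j G - bd (w' j) G) i = 0"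
    proof -
      have "\<forall>j<length (b (Suc l)). z' j G - bd (w' j) G = ?mv (Suc l) (\<lambda>m. y' m G) j"
        using z' by simp
      then show ?thesis
        using exact[of "\<lambda>j. z' j G - bd (w' j) G"] i by blast
    qed
    finally show "bd (\<lambda>F. z i F - ?mv l (\<lambda>j. w' j F) i) G = 0"
      by (simp add: bd_diff bd_mat_vec)
  next
    \<comment> \<open>Minimality keeps the correction free of constant terms.\<close>
    have "lookup (?mv l (\<lambda>j. w' j {}) i) 0 = 0"
      by (simp add: mat_vec_def lookup_sum lookup_mult_0 min i)
    then show "lookup (z i {} - ?mv l (\<lambda>j. w' j {}) i) 0 = 0"
      using Suc.prems(1)[OF i, of "{}"] by (simp add: lookup_minus)
  qed
  then obtain w where w: "\<forall>i<length (b l). \<forall>F. z i F - ?mv l (\<lambda>j. w' j F) i = bd (w i) F"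
    by metis
  show ?case
    by (intro exI[of _ w] exI[of _ w']) (use w in \<open>simp add: algebra_simps\<close>)
qed

text \<open>Koszul homology with coefficients in \<open>I\<close> is Tor of \<open>I\<close> and the
  base field, whose \<open>r\<close>-th part lives in the degrees of the generators of
  \<open>F\<^sub>r\<close>. A cycle of larger total degree \<open>D\<close> therefore bounds a chain
  in \<open>I\<close>.\<close>

lemma koszul_homology_eq_0:
  fixes z :: "'n::{finite,linorder} set \<Rightarrow> ('n, 'k::field) mpoly"
  assumes res: "minimal_graded_free_resolution I b e \<phi>"
    and supp: "\<And>F. card F \<noteq> r \<Longrightarrow> z F = 0"
    and hom: "\<And>F. homogeneous (D - int r) (z F)"
    and I: "\<And>F. z F \<in> I" and cycle: "\<And>G. bd z G = 0"
    and deg: "\<And>d. d \<in> set (b r) \<Longrightarrow> d < D"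
  shows "\<exists>w. \<forall>F. w F \<in> I \<and> z F = bd w F"
proof -
  let ?\<epsilon> = "\<lambda>v. \<Sum>j<length (b 0). e j * v j"
  have home: "homogeneous (b 0 ! j) (e j)" if "j < length (b 0)" for j
    using res that by (simp add: minimal_graded_free_resolution_def graded_free_resolution_def)
  have Ieq: "I = range ?\<epsilon>" and exact: "?\<epsilon> v = 0 \<longleftrightarrow>
      (\<exists>w. \<forall>i<length (b 0). v i = mat_vec (length (b 1)) (\<phi> 0) w i)" for v
    using res by (simp_all add: minimal_graded_free_resolution_def graded_free_resolution_def)
  have "\<forall>F. \<exists>v. z F = ?\<epsilon> v"
    using I unfolding Ieq by (simp add: image_iff)
  then obtain v where v: "\<forall>F. z F = ?\<epsilon> (v F)"
    by (rule choice[THEN exE])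
  define z' where "z' j F = (if card F = r then hcomp (D - int r - b 0 ! j) (v F j) else 0)" for j F
  have z: "z F = ?\<epsilon> (\<lambda>j. z' j F)" for F
  proof (cases "card F = r")
    case True
    have "z F = hcomp (D - int r) (?\<epsilon> (v F))"
      using v hom[of F] by (simp add: hcomp_homogeneous)
    also have "\<dots> = ?\<epsilon> (\<lambda>j. z' j F)"
      unfolding hcomp_sum using True
      by (intro sum.cong refl) (simp add: z'_def hcomp_mult[OF home])
    finally show ?thesis .
  qed (simp add: supp z'_def)
  have bd_\<epsilon>: "bd (\<lambda>F. ?\<epsilon> (\<lambda>j. y j F)) G = ?\<epsilon> (\<lambda>j. bd (y j) G)"
    for y :: "nat \<Rightarrow> 'n set \<Rightarrow> ('n, 'k) mpoly" and G
    by (simp add: bd_sum bd_mult)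
  have "\<exists>w y. \<forall>F. \<forall>i<length (b 0). z' i F = bd (w i) F +
      mat_vec (length (b (Suc 0))) (\<phi> 0) (\<lambda>j. y j F) i"
  proof (rule koszul_chase[OF res, of 0 r])
    show "z' i F = 0" if "card F \<noteq> r" for i F
      using that by (simp add: z'_def)
    show "homogeneous (D - int r - b 0 ! i) (z' i F)" for i F
      by (simp add: z'_def homogeneous_hcomp)
    show "d < D" if "d \<in> set (b (0 + r))" for d
      using deg that by simp
    fix G
    have "?\<epsilon> (\<lambda>j. bd (z' j) G) = bd z G"
      using z bd_\<epsilon>[of z' G] by presburger
    then show "\<exists>v. \<forall>i<length (b 0). bd (z' i) G = mat_vec (length (b (Suc 0))) (\<phi> 0) v i"
      using exact cycle by simp
  qed
  then obtain w y where wy: "\<forall>F. \<forall>i<length (b 0). z' i F = bd (w i) F +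
      mat_vec (length (b (Suc 0))) (\<phi> 0) (\<lambda>j. y j F) i"
    by (elim exE) (rule that)
  have "z F = bd (\<lambda>F. ?\<epsilon> (\<lambda>j. w j F)) F" for F
  proof -
    \<comment> \<open>The part of \<open>z'\<close> that is not a boundary comes from
      \<open>F\<^sub>1\<close> and dies in \<open>I\<close>.\<close>
    have "z F - bd (\<lambda>F. ?\<epsilon> (\<lambda>j. w j F)) F = ?\<epsilon> (\<lambda>j. z' j F - bd (w j) F)"
      using z[of F] by (simp add: bd_\<epsilon> algebra_simps sum_subtractf)
    also have "\<dots> = 0"
      using exact[of "\<lambda>j. z' j F - bd (w j) F"] wy by auto
    finally show ?thesis by simp
  qed
  moreover have "?\<epsilon> (\<lambda>j. w j F) \<in> I" for F
    unfolding Ieq by (rule rangeI)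
  ultimately show ?thesis
    by (intro exI[of _ "\<lambda>F. ?\<epsilon> (\<lambda>j. w j F)"]) simp
qed

lemma m_regular_resolution:
  fixes I :: "('n::finite, 'k::field) mpoly set"
  assumes "m_regular m I"
  obtains b e \<phi> where "minimal_graded_free_resolution I b e \<phi>"
    "\<And>k d. d \<in> set (b k) \<Longrightarrow> d \<le> m + int k"
proof -
  let ?S = "{Sup {ereal (of_int (d - int k)) | k d. d \<in> set (b k)} | b e \<phi>.
           minimal_graded_free_resolution I b e \<phi>}"
  \<comment> \<open>A strict bound avoids asking whether the infimum is attained; as the degrees are
    integers, \<open>m + 1\<close> excluded means at most \<open>m\<close>.\<close>
  have "Inf ?S < ereal (of_int (m + 1))"
    using assms unfolding m_regular_def cm_regularity_def
    by (rule le_less_trans) simp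
  then obtain b e \<phi> where res: "minimal_graded_free_resolution I b e \<phi>"
    and lt: "Sup {ereal (of_int (d - int k)) | k d. d \<in> set (b k)} < ereal (of_int (m + 1))"
    unfolding Inf_less_iff by blast
  have "d \<le> m + int k" if "d \<in> set (b k)" for k d
  proof -
    have "ereal (of_int (d - int k)) \<le> Sup {ereal (of_int (d - int k)) | k d. d \<in> set (b k)}"
      by (rule Sup_upper) (use that in blast)
    then have "ereal (of_int (d - int k)) < ereal (of_int (m + 1))"
      using lt by (rule le_less_trans)
    then show ?thesis by simp
  qed
  then show ?thesis by (rule that[OF res])
qed

text \<open>The generators of \<open>I\<close> would have negative degree, and only 0 is homogeneous
  of negative degree.\<close>

lemma m_regular_negative:
  fixes I :: "('n::finite, 'k::field) mpoly set"
  assumes "m_regular m I" and "m < 0"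
  shows "I = {0}"
proof -
  obtain b e \<phi> where res: "minimal_graded_free_resolution I b e \<phi>"
    and deg: "\<And>k d. d \<in> set (b k) \<Longrightarrow> d \<le> m + int k"
    using m_regular_resolution[OF assms(1)] by blast
  have "e j = 0" if "j < length (b 0)" for j
  proof -
    have "b 0 ! j < 0" using deg[of "b 0 ! j" 0] that assms(2) by simp
    moreover have "homogeneous (b 0 ! j) (e j)"
      using res that by (simp add: minimal_graded_free_resolution_def graded_free_resolution_def)
    ultimately have "keys (e j) = {}"
      by (fastforce simp: homogeneous_def)
    then show ?thesis by simp
  qed
  moreover have "I = range (\<lambda>v. \<Sum>j<length (b 0). e j * v j)"
    using res by (simp add: minimal_graded_free_resolution_def graded_free_resolution_def)
  ultimately show ?thesis by auto
qed

subsection \<open>Borel-fixed ideals\<close>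

lemma ideal_0: "is_ideal I \<Longrightarrow> 0 \<in> I"
  by (simp add: is_ideal_def mpoly_mod.subspace_0)

lemma ideal_diff: "is_ideal I \<Longrightarrow> f \<in> I \<Longrightarrow> g \<in> I \<Longrightarrow> f - g \<in> I"
  by (simp add: is_ideal_def mpoly_mod.subspace_diff)

lemma ideal_mult: "is_ideal I \<Longrightarrow> f \<in> I \<Longrightarrow> g * f \<in> I"
  by (simp add: is_ideal_def mpoly_mod.subspace_scale)

lemma ideal_sum: "is_ideal I \<Longrightarrow> (\<And>i. i \<in> A \<Longrightarrow> f i \<in> I) \<Longrightarrow> sum f A \<in> I"
  by (simp add: is_ideal_def mpoly_mod.subspace_sum)

lemma lookup_Const_mult_term_poly: "lookup (Const c * term_poly t) s = (if t = s then c else 0)"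
  by (simp add: Const_def term_poly_def mult_single lookup_single when_def)

lemma term_poly_add: "term_poly (s + t) = term_poly s * term_poly t"
  by (simp add: term_poly_def mult_single)

lemma Var_eq_term_poly: "Var i = term_poly (var_term i)"
  by (simp add: Var_eq term_poly_def)

lemma ideal_term_poly_add: "is_ideal I \<Longrightarrow> term_poly t \<in> I \<Longrightarrow> term_poly (t + s) \<in> I"
  unfolding add.commute[of t s] term_poly_add by (rule ideal_mult)

lemma keys_term_poly [simp]: "keys (term_poly t :: ('n, 'k::field) mpoly) = {t}"
  by (simp add: term_poly_def)

lemma Const_power: "Const c ^ k = Const (c ^ k)"
  by (induction k) (simp_all add: Const_def mult_single)

lemma Const_mult_Const: "Const a * Const b = Const (a * b)"
  by (simp add: Const_def mult_single)

lemma Const_0 [simp]: "Const 0 = 0"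
  by (simp add: Const_def)

lemma Const_1 [simp]: "Const 1 = 1"
  by (simp add: Const_def)

lemma Var_power: "Var i ^ k = term_poly (single i k)"
proof (induction k)
  case (Suc k)
  have "single i (Suc k) = single i (Suc 0) + single i k"
    by (simp flip: single_add)
  then show ?case
    using Suc by (simp add: term_poly_add Var_eq_term_poly var_term_def)
qed (simp add: term_poly_def)

lemma prod_term_poly: "(\<Prod>i\<in>A. term_poly (f i)) = term_poly (sum f A)"
proof (induction A rule: infinite_finite_induct)
  case (insert x F)
  then show ?case by (simp add: term_poly_add)
qed (simp_all add: term_poly_def)

lemma sum_single: "(\<Sum>i\<in>UNIV. single i (lookup t i)) = (t :: 'n::finite pterm)"
  by (rule poly_mapping_eqI) (simp add: lookup_sum lookup_single when_def)

lemma prod_Var_power: "(\<Prod>i\<in>UNIV. Var i ^ lookup t i) = term_poly (t :: 'n::finite pterm)"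
  unfolding Var_power prod_term_poly sum_single ..

text \<open>\<open>h\<close> is the image of \<open>f\<close> under the diagonal matrix that
  multiplies \<open>x\<^sub>i\<close> by \<open>a\<close>.\<close>

lemma borel_fixed_scale_mem:
  fixes I :: "('n::{finite,linorder}, 'k::field) mpoly set"
  assumes "borel_fixed I" and "a \<noteq> 0" and "f \<in> I"
  obtains h where "h \<in> I" and "\<And>t. lookup h t = a ^ lookup t i * lookup f t"
proof
  let ?c = "\<lambda>c l. if l = i then c else (1::'k)"
  define g :: "'k \<Rightarrow> (('k, 'n) vec, 'n) vec" where "g c = (\<chi> l j. if l = j then ?c c l else 0)" for c
  have "g c ** g d = mat 1" if "c * d = 1" for c d
  proof -
    have "(g c ** g d) $ l $ j = mat 1 $ l $ j" for l j
    proof -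
      have "(g c ** g d) $ l $ j = (\<Sum>k\<in>UNIV. if l = k then ?c c l * g d $ l $ j else 0)"
        unfolding matrix_matrix_mult_def vec_lambda_beta
        by (intro sum.cong refl) (simp add: g_def)
      also have "\<dots> = mat 1 $ l $ j"
        using that by (simp add: g_def mat_def)
      finally show ?thesis .
    qed
    then show ?thesis by (simp add: vec_eq_iff)
  qed
  then have "g a ** g (inverse a) = mat 1 \<and> g (inverse a) ** g a = mat 1"
    using \<open>a \<noteq> 0\<close> by simp
  then have "invertible (g a)"
    unfolding invertible_def by blast
  moreover have "upper_triangular (g a)"
    by (auto simp: upper_triangular_def g_def)
  ultimately show "gl_action (g a) f \<in> I"
    using assms unfolding borel_fixed_def by blast
  have row: "(\<Sum>j\<in>UNIV. Const (g a $ l $ j) * Var j) = Const (?c a l) * Var l" for l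
  proof -
    have "(\<Sum>j\<in>UNIV. Const (g a $ l $ j) * Var j) = (\<Sum>j\<in>UNIV. if l = j then Const (?c a l) * Var l else 0)"
      by (intro sum.cong) (auto simp: g_def)
    then show ?thesis by simp
  qed
  have prod: "(\<Prod>l\<in>UNIV. (Const (?c a l) * Var l) ^ lookup t l) =
      Const (a ^ lookup t i) * (term_poly t :: ('n, 'k) mpoly)" for t
  proof -
    have "(\<Prod>l\<in>UNIV. (Const (?c a l) :: ('n, 'k) mpoly) ^ lookup t l) =
        (\<Prod>l\<in>UNIV. if l = i then Const (a ^ lookup t i) else 1)"
      by (intro prod.cong) (auto simp: Const_power)
    then show ?thesis
      by (simp add: power_mult_distrib prod.distrib prod_Var_power)
  qed
  show "lookup (gl_action (g a) f) t = a ^ lookup t i * lookup f t" for t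
  proof -
    have "gl_action (g a) f =
        (\<Sum>s\<in>keys f. Const (lookup f s * a ^ lookup s i) * term_poly s)"
      unfolding gl_action_def row prod by (simp add: Const_mult_Const flip: mult.assoc)
    then show ?thesis
      by (simp add: lookup_sum lookup_Const_mult_term_poly in_keys_iff)
  qed
qed

text \<open>Induction on the number of terms: rescaling a variable in which two terms differ allows
  one to be cancelled while the other survives.\<close>

lemma borel_fixed_monomial:
  fixes I :: "('n::{finite,linorder}, 'k::field) mpoly set"
  assumes inf: "infinite (UNIV :: 'k set)" and ideal: "is_ideal I" and borel: "borel_fixed I"
    and "f \<in> I" and "t \<in> keys f"
  shows "term_poly t \<in> I"
  using assms(4,5)
proof (induction "card (keys f)" arbitrary: f rule: less_induct)
  case less
  show ?case
  proof (cases "keys f = {t}")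
    case True
    then have "lookup f t \<noteq> 0" and "\<And>s. s \<noteq> t \<Longrightarrow> lookup f s = 0"
      by (auto simp: in_keys_iff set_eq_iff)
    then have "term_poly t = Const (inverse (lookup f t)) * f"
      by (intro poly_mapping_eqI)
        (auto simp: lookup_Const_mult term_poly_def lookup_single when_def)
    then show ?thesis using less.prems(1) ideal by (simp add: ideal_mult)
  next
    case False
    then obtain s where s: "s \<in> keys f" "s \<noteq> t" using less.prems(2) by blast
    then obtain i where i: "lookup s i \<noteq> lookup t i"
      by (auto simp: poly_mapping_eq_iff fun_eq_iff)
    \<comment> \<open>Since the field is infinite, some nonzero \<open>a\<close> is not a root of
      this nonzero polynomial.\<close>
    let ?p = "Polynomial.monom 1 (lookup t i) - Polynomial.monom 1 (lookup s i) :: 'k poly"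
    have "poly.coeff ?p (lookup t i) \<noteq> 0" using i by simp
    then have "?p \<noteq> 0" by (metis coeff_0)
    then have "finite {a. poly ?p a = 0}" by (rule poly_roots_finite)
    then have "finite (insert 0 {a. poly ?p a = 0})" by (rule finite.insertI)
    then obtain a where "a \<notin> insert 0 {a. poly ?p a = 0}"
      using inf ex_new_if_finite by blast
    then have a: "a \<noteq> 0" "a ^ lookup t i \<noteq> a ^ lookup s i"
      by (auto simp: poly_monom)
    obtain h where h: "h \<in> I" "\<And>u. lookup h u = a ^ lookup u i * lookup f u"
      using borel_fixed_scale_mem[OF borel a(1) less.prems(1)] by metis
    define h' where "h' = h - Const (a ^ lookup s i) * f"
    have h': "lookup h' u = (a ^ lookup u i - a ^ lookup s i) * lookup f u" for u
      by (simp add: h'_def lookup_minus lookup_Const_mult h(2) left_diff_distrib)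
    have "keys h' \<subseteq> keys f - {s}"
      by (auto simp: in_keys_iff h')
    then have "card (keys h') < card (keys f)"
      using s(1) by (intro psubset_card_mono) auto
    moreover have "h' \<in> I"
      unfolding h'_def using h(1) less.prems(1) ideal by (intro ideal_diff ideal_mult)
    moreover have "t \<in> keys h'"
      using a(2) less.prems(2) by (simp add: in_keys_iff h')
    ultimately show ?thesis by (rule less.hyps)
  qed
qed

text \<open>The substitution of \<open>x\<^sub>i + x\<^sub>j\<close> for \<open>x\<^sub>i\<close> is
  upper triangular as \<open>i < j\<close>. In the binomial expansion every term with nonzero
  coefficient lies in \<open>I\<close>.\<close>

lemma borel_fixed_exchange:
  fixes I :: "('n::{finite,linorder}, 'k::field) mpoly set"
  assumes inf: "infinite (UNIV :: 'k set)" and ideal: "is_ideal I" and borel: "borel_fixed I"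
    and "i < j" and u: "lookup u i = 0" and mem: "term_poly (u + single i r) \<in> I"
    and "k \<le> r" and binom: "of_nat (r choose k) \<noteq> (0 :: 'k)"
  shows "term_poly (u + single i k + single j (r - k)) \<in> I"
proof -
  define g :: "'k \<Rightarrow> (('k, 'n) vec, 'n) vec" where
    "g c = (\<chi> a b. (if a = b then 1 else 0) + (if a = i \<and> b = j then c else 0))" for c
  have "g c ** g d = mat 1" if "c + d = 0" for c d
  proof -
    have "(g c ** g d) $ a $ b = mat 1 $ a $ b" for a b
    proof -
      have "(g c ** g d) $ a $ b = (\<Sum>l\<in>UNIV. (if l = a then g d $ l $ b else 0) +
          (if l = j then if a = i then c * g d $ l $ b else 0 else 0))"
        unfolding matrix_matrix_mult_def by (auto simp: g_def intro!: sum.cong split: if_splits)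
          (simp_all add: algebra_simps)
      also have "\<dots> = g d $ a $ b + (if a = i then c * g d $ j $ b else 0)"
        by (simp add: sum.distrib)
      also have "\<dots> = mat 1 $ a $ b"
        using that \<open>i < j\<close> by (auto simp: g_def mat_def add.commute)
      finally show ?thesis .
    qed
    then show ?thesis by (simp add: vec_eq_iff)
  qed
  then have "g 1 ** g (-1) = mat 1 \<and> g (-1) ** g 1 = mat 1"
    by simp
  then have "invertible (g 1)"
    unfolding invertible_def by blast
  moreover have "upper_triangular (g 1)"
    using \<open>i < j\<close> by (auto simp: upper_triangular_def g_def)
  ultimately have "gl_action (g 1) (term_poly (u + single i r)) \<in> I"
    using borel mem unfolding borel_fixed_def by blast
  moreover have "gl_action (g 1) (term_poly (u + single i r)) =
      (\<Sum>q\<le>r. Const (of_nat (r choose q)) * term_poly (u + single i q + single j (r - q)))"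
  proof -
    let ?L = "\<lambda>l. \<Sum>b\<in>UNIV. Const (g 1 $ l $ b) * Var b"
    have row: "?L l = Var l + (if l = i then Var j else 0)" for l
    proof -
      have "?L l = (\<Sum>b\<in>UNIV. (if b = l then Var l else 0) +
          (if b = j then if l = i then Var j else 0 else 0))"
        using \<open>i < j\<close> by (intro sum.cong) (auto simp: g_def)
      then show ?thesis by (simp add: sum.distrib)
    qed
    have "gl_action (g 1) (term_poly (u + single i r)) =
        (\<Prod>l\<in>UNIV. ?L l ^ lookup (u + single i r) l)"
      by (simp add: gl_action_def) (simp add: term_poly_def)
    also have "\<dots> = (\<Prod>l\<in>UNIV. Var l ^ lookup u l * (if l = i then (Var i + Var j) ^ r else 1))"
      using u by (intro prod.cong) (auto simp: row lookup_add lookup_single)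
    also have "\<dots> = term_poly u * (Var i + Var j) ^ r"
      by (simp add: prod.distrib prod_Var_power)
    also have "\<dots> = (\<Sum>q\<le>r. Const (of_nat (r choose q)) * term_poly (u + single i q + single j (r - q)))"
      by (simp add: binomial_ring sum_distrib_left Var_power term_poly_add Const_def algebra_simps)
    finally show ?thesis .
  qed
  ultimately have mem: "(\<Sum>q\<le>r. Const (of_nat (r choose q)) * term_poly (u + single i q + single j (r - q))) \<in> I"
    (is "?f \<in> I") by simp
  \<comment> \<open>The exponent of \<open>x\<^sub>i\<close> separates the terms of the expansion,
    so no coefficients are added up.\<close>
  have "u + single i q + single j (r - q) = u + single i k + single j (r - k) \<longleftrightarrow> q = k" for q
  proof
    assume "u + single i q + single j (r - q) = u + single i k + single j (r - k)"
    from arg_cong[OF this, of "\<lambda>t. lookup t i"] show "q = k"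
      using \<open>i < j\<close> by (simp add: lookup_add lookup_single)
  qed simp
  then have "lookup ?f (u + single i k + single j (r - k)) = of_nat (r choose k)"
    using \<open>k \<le> r\<close> by (simp add: lookup_sum lookup_Const_mult_term_poly)
  then show ?thesis
    using borel_fixed_monomial[OF inf ideal borel mem] binom by (simp add: in_keys_iff)
qed

text \<open>In characteristic 0 take \<open>N = 1\<close>. Otherwise multiples of
  \<open>CHAR('k) * fact r\<close> work: for them the binomial coefficient becomes 1 in the
  field.\<close>

lemma ex_binomial_nonzero:
  shows "\<exists>N>0. of_nat (N + r choose r) \<noteq> (0 :: 'k::field)"
proof (cases "CHAR('k) = 0")
  case True
  then have "of_nat n = (0 :: 'k) \<longleftrightarrow> n = 0" for n
    by (simp add: of_nat_eq_0_iff_char_dvd)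
  then have "of_nat (1 + r choose r) \<noteq> (0 :: 'k)"
    by (simp only: binomial_eq_0_iff)
  then show ?thesis by (meson zero_less_one)
next
  case False
  have "of_nat (CHAR('k) * fact r * q + r choose r) = (1 :: 'k)" for q
  proof (induction r arbitrary: q)
    case (Suc r)
    let ?N = "CHAR('k) * fact (Suc r) * q"
    have N: "?N = CHAR('k) * fact r * (Suc r * q)" by (simp add: algebra_simps)
    \<comment> \<open>The factorial makes \<open>Suc r\<close> divide \<open>?N\<close>, so
      \<open>Suc r\<close> can be cancelled among natural numbers, before passing to the field where
      it may be 0.\<close>
    have "Suc r * (?N + Suc r choose Suc r) = (?N + Suc r) * (?N + r choose r)"
      using Suc_times_binomial[of r "?N + r"] by simp
    also have "(?N + Suc r) * B = Suc r * ((1 + CHAR('k) * fact r * q) * B)" for B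
      by (simp add: algebra_simps)
    finally have "Suc r * (?N + Suc r choose Suc r) =
        Suc r * ((1 + CHAR('k) * fact r * q) * (?N + r choose r))" .
    then have "?N + Suc r choose Suc r = (1 + CHAR('k) * fact r * q) * (?N + r choose r)"
      by (simp only: nat_mult_eq_cancel1 zero_less_Suc)
    moreover have "of_nat (1 + CHAR('k) * fact r * q) = (1 :: 'k)"
      by simp
    moreover have "of_nat (?N + r choose r) = (1 :: 'k)"
      using Suc.IH[of "Suc r * q"] by (simp only: N)
    ultimately show ?case
      by (simp only: of_nat_mult mult_1)
  qed simp
  from this[of 1] show ?thesis
    using False by (intro exI[of _ "CHAR('k) * fact r"]) simp
qed

text \<open>With \<open>r\<close> the exponent of \<open>x\<^sub>i\<close> in \<open>t\<close>,
  raise that exponent to \<open>N + r\<close> and trade \<open>N\<close> factors for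
  \<open>x\<^sub>j\<close>; \<open>N\<close> is chosen so that the binomial coefficient does not
  vanish.\<close>

lemma borel_fixed_power_mem:
  fixes I :: "('n::{finite,linorder}, 'k::field) mpoly set"
  assumes inf: "infinite (UNIV :: 'k set)" and ideal: "is_ideal I" and borel: "borel_fixed I"
    and mem: "term_poly (t + var_term i) \<in> I" and "i < j"
  shows "\<exists>N. term_poly (t + single j N) \<in> I"
proof -
  define r where "r = lookup t i"
  define u where "u = t - single i r"
  obtain N where N: "N > 0" "of_nat (N + r choose r) \<noteq> (0 :: 'k)"
    using ex_binomial_nonzero by blast
  have t: "t = u + single i r" and u: "lookup u i = 0"
    by (auto intro!: poly_mapping_eqI simp: u_def r_def lookup_add lookup_minus lookup_single when_def)
  have "u + single i (N + r) = t + var_term i + single i (N - 1)"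
    using N(1) unfolding t
    by (intro poly_mapping_eqI) (simp add: lookup_add lookup_single lookup_var_term when_def)
  then have "term_poly (u + single i (N + r)) \<in> I"
    using ideal_term_poly_add[OF ideal mem] by simp
  from borel_fixed_exchange[OF inf ideal borel \<open>i < j\<close> u this, of r] N(2)
  show ?thesis by (auto simp: t)
qed

text \<open>
  If \<open>t \<notin> I\<close>, a multiple \<open>t'\<close> of \<open>t\<close> by a term in \<open>x\<^sub>i, \<dots>, x\<^sub>n\<close> that is maximal outside of \<open>I\<close>
  is a socle element modulo \<open>I\<close> with respect to \<open>x\<^sub>i, \<dots>, x\<^sub>n\<close>.  The Koszul boundary of \<open>t'\<close> is then
  a cycle with coefficients in \<open>I\<close> that is no boundary, in a degree that is too large for regularity.
\<close>

lemma borel_fixed_regular_quotient: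
  fixes I :: "('n::{finite,linorder}, 'k::field) mpoly set"
  assumes inf: "infinite (UNIV :: 'k set)" and ideal: "is_ideal I" and borel: "borel_fixed I"
    and reg: "m_regular m I" and deg: "m \<le> int (term_degree t)"
    and mem: "term_poly (t + var_term i) \<in> I" and low: "\<And>l. l < i \<Longrightarrow> lookup t l = 0"
  shows "term_poly t \<in> I"
proof (rule ccontr)
  assume "term_poly t \<notin> I"
  have "\<exists>N. term_poly (t + single l N) \<in> I" if "i \<le> l" for l
    using borel_fixed_power_mem[OF inf ideal borel mem, of l] mem that
    by (cases "i = l") (auto simp: var_term_def)
  then obtain N where N: "\<And>l. i \<le> l \<Longrightarrow> term_poly (t + single l (N l)) \<in> I" by metis
  define P where "P w \<longleftrightarrow> (\<forall>l<i. lookup w l = 0) \<and> term_poly (t + w) \<notin> I" for w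
  have "P 0" using \<open>term_poly t \<notin> I\<close> by (simp add: P_def)
  \<comment> \<open>Finitely many multiples of \<open>t\<close> by terms in
    \<open>x\<^sub>i, \<dots>, x\<^sub>n\<close> avoid \<open>I\<close>, since a power of each of
    these variables carries \<open>t\<close> into \<open>I\<close>.\<close>
  have bound: "term_degree w \<le> (\<Sum>l\<in>UNIV. N l)" if "P w" for w
    unfolding term_degree_def
  proof (rule sum_mono)
    fix l
    show "lookup w l \<le> N l"
    proof (rule ccontr)
      assume l: "\<not> lookup w l \<le> N l"
      then have "lookup w l \<noteq> 0" by simp
      then have "i \<le> l" using \<open>P w\<close> unfolding P_def by (metis not_le)
      have "t + w = t + single l (N l) + (w - single l (N l))"
        using l by (intro poly_mapping_eqI) (auto simp: lookup_add lookup_minus lookup_single when_def)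
      then have "term_poly (t + w) \<in> I"
        using ideal_term_poly_add[OF ideal N[OF \<open>i \<le> l\<close>]] by metis
      then show False using \<open>P w\<close> by (simp add: P_def)
    qed
  qed
  then have "\<forall>w. P w \<longrightarrow> term_degree w < Suc (\<Sum>l\<in>UNIV. N l)"
    by (simp add: less_Suc_eq_le)
  from ex_has_greatest_nat[OF \<open>P 0\<close> this] obtain w where
    w: "P w" and w_max: "\<And>w'. P w' \<Longrightarrow> term_degree w' \<le> term_degree w" by blast
  define t' where "t' = t + w"
  have t': "term_poly t' \<notin> I" and low': "\<And>l. l < i \<Longrightarrow> lookup t' l = 0"
    using w low by (auto simp: P_def t'_def lookup_add)
  have socle: "term_poly (t' + var_term l) \<in> I" if "i \<le> l" for l
  proof (rule ccontr)
    assume "term_poly (t' + var_term l) \<notin> I"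
    then have "P (w + var_term l)"
      using w that by (auto simp: P_def t'_def lookup_add lookup_var_term add.assoc)
    from w_max[OF this] show False by (simp add: term_degree_add)
  qed
  \<comment> \<open>The chain \<open>y\<close> is \<open>t'\<close> times the wedge of all
    \<open>e\<^sub>l\<close> with \<open>i \<le> l\<close>; its coefficient is outside
    \<open>I\<close>, its boundary inside by the socle property.\<close>
  define T where "T = {i..}"
  have "i \<in> T" by (simp add: T_def)
  define r where "r = card T - 1"
  have r: "card T = Suc r"
    using card_gt_0_iff[of T] \<open>i \<in> T\<close> unfolding r_def by fastforce
  define y :: "'n set \<Rightarrow> ('n, 'k) mpoly" where "y F = (if F = T then term_poly t' else 0)" for F
  obtain b e \<phi> where res: "minimal_graded_free_resolution I b e \<phi>"
    and degb: "\<And>k d. d \<in> set (b k) \<Longrightarrow> d \<le> m + int k"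
    using m_regular_resolution[OF reg] by blast
  \<comment> \<open>The total degree of \<open>y\<close>. It is at least \<open>m + r + 1\<close>,
    just above the bound \<open>m + r\<close> for the generators of
    \<open>F\<^sub>r\<close>.\<close>
  define D where "D = int (term_degree t') + int (Suc r)"
  have "\<exists>w. \<forall>F. w F \<in> I \<and> bd y F = bd w F"
  proof (rule koszul_homology_eq_0[OF res, of r])
    show "bd y F = 0" if "card F \<noteq> r" for F
    proof (rule bd_eq_0)
      fix l assume "l \<notin> F"
      then have "insert l F \<noteq> T" using that r by auto
      then show "y (insert l F) = 0" by (simp add: y_def)
    qed
    have "homogeneous (int (term_degree t')) (y F)" for F
      by (simp add: y_def homogeneous_def)
    from homogeneous_bd[OF this] show "homogeneous (D - int r) (bd y F)" for F
      by (simp add: D_def add.commute)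
    have "Var l * y (insert l F) \<in> I" for l F
    proof (cases "insert l F = T")
      case True
      then have "i \<le> l" by (auto simp: T_def)
      then show ?thesis
        using socle[of l] True by (simp add: y_def Var_eq_term_poly add.commute flip: term_poly_add)
    qed (simp add: y_def ideal ideal_0)
    then show "bd y F \<in> I" for F
      unfolding bd_def by (intro ideal_sum[OF ideal] ideal_mult[OF ideal, of "Var _ * _"])
    show "bd (bd y) G = 0" for G by (rule bd_bd)
    have "term_degree t \<le> term_degree t'" by (simp add: t'_def term_degree_add)
    then show "d < D" if "d \<in> set (b r)" for d
      using degb[OF that] deg by (simp add: D_def)
  qed
  then obtain v where vI: "\<And>F. v F \<in> I" and v: "\<And>F. bd y F = bd v F" by blast
  \<comment> \<open>At \<open>t' x\<^sub>i\<close> the boundary on \<open>T - {i}\<close> sees only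
    the coefficient of \<open>t'\<close> on \<open>T\<close>, as no \<open>x\<^sub>l\<close> with
    \<open>l < i\<close> divides \<open>t'\<close>. So \<open>v T\<close> would contain
    \<open>t'\<close>.\<close>
  have "-(T - {i}) = insert i {..<i}"
    by (auto simp: T_def)
  then have coeff: "lookup (bd x (T - {i})) (t' + var_term i) = lookup (x T) t'" for x
  proof -
    have none: "{k \<in> T - {i}. k < i} = {}" by (auto simp: T_def)
    have "lookup (bd x (T - {i})) (t' + var_term i) =
        (\<Sum>l\<in>insert i {..<i}. if l = i then lookup (x T) t' else 0)"
      unfolding lookup_bd \<open>-(T - {i}) = insert i {..<i}\<close>
    proof (rule sum.cong[OF refl])
      fix l assume "l \<in> insert i {..<i}"
      then consider "l = i" | "l < i" by auto
      then show "(if lookup (t' + var_term i) l = 0 then 0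
          else (-1) ^ card {k \<in> T - {i}. k < l} *
            lookup (x (insert l (T - {i}))) (t' + var_term i - var_term l)) =
          (if l = i then lookup (x T) t' else 0)"
      proof cases
        case 1
        then show ?thesis
          using \<open>i \<in> T\<close> by (simp add: none lookup_add lookup_var_term insert_absorb del: Diff_iff)
      next
        case 2
        then show ?thesis using low'[of l] by (auto simp add: lookup_add lookup_var_term)
      qed
    qed
    then show ?thesis by simp
  qed
  have "lookup (v T) t' = lookup (y T) t'"
    using coeff[of v] coeff[of y] v[of "T - {i}"] by simp
  then have "lookup (v T) t' = 1"
    by (simp add: y_def term_poly_def)
  then have "t' \<in> keys (v T)" by (simp add: in_keys_iff)
  then show False
    using borel_fixed_monomial[OF inf ideal borel vI] t' by blast
qed

subsection \<open>Degrevlex and the least variable of a term\<close>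

text \<open>Inserting \<open>Max UNIV\<close> gives \<open>mv 1 = x\<^sub>n\<close>, for which the recursion \<open>num_mv_Suc\<close> also starts correctly.\<close>

definition mv :: "'n::{finite,linorder} pterm \<Rightarrow> 'n"
  where "mv t = Min (insert (Max UNIV) (keys t))"

lemma le_mv_iff: "j \<le> mv t \<longleftrightarrow> (\<forall>l<j. lookup t l = 0)"
proof -
  have "j \<le> mv t \<longleftrightarrow> (\<forall>l\<in>insert (Max UNIV) (keys t). j \<le> l)"
    unfolding mv_def by (rule Min_ge_iff) auto
  also have "\<dots> \<longleftrightarrow> (\<forall>l\<in>keys t. j \<le> l)" by simp
  also have "\<dots> \<longleftrightarrow> (\<forall>l<j. lookup t l = 0)"
    unfolding in_keys_iff Ball_def by (metis not_le)
  finally show ?thesis .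
qed

lemma lookup_mv:
  assumes "t \<noteq> 0"
  shows "lookup t (mv t) \<noteq> 0"
proof -
  have "keys t \<noteq> {}" using assms by auto
  then have "mv t = Min (keys t)"
    by (auto simp: mv_def min_def intro!: antisym)
  then show ?thesis
    using Min_in[of "keys t"] \<open>keys t \<noteq> {}\<close> by (simp add: in_keys_iff)
qed

lemma mv_add_var_term:
  assumes "j \<le> mv t"
  shows "mv (t + var_term j) = j"
proof (rule antisym)
  show "j \<le> mv (t + var_term j)"
    using assms by (auto simp: le_mv_iff lookup_add lookup_var_term)
  have "\<not> j < mv (t + var_term j)"
  proof
    assume "j < mv (t + var_term j)"
    moreover have "\<forall>l<mv (t + var_term j). lookup (t + var_term j) l = 0"
      using le_mv_iff by blast
    ultimately have "lookup (t + var_term j) j = 0" by blast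
    then show False by (simp add: lookup_add lookup_var_term)
  qed
  then show "mv (t + var_term j) \<le> j" by simp
qed

lemma term_degree_diff_mv:
  assumes "term_degree u = Suc d"
  shows "u - var_term (mv u) + var_term (mv u) = u" "term_degree (u - var_term (mv u)) = d"
    "mv u \<le> mv (u - var_term (mv u))"
proof -
  have "u \<noteq> 0" using assms by auto
  then show *: "u - var_term (mv u) + var_term (mv u) = u"
    by (intro var_term_diff_add lookup_mv)
  have "term_degree (u - var_term (mv u) + var_term (mv u)) = Suc d"
    using assms by (simp only: *)
  then show "term_degree (u - var_term (mv u)) = d"
    by (simp add: term_degree_add)
  have "\<forall>l<mv u. lookup u l = 0" using le_mv_iff by blast
  then show "mv u \<le> mv (u - var_term (mv u))"
    by (simp add: le_mv_iff lookup_minus)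
qed

lemma degrevlex_irrefl: "\<not> degrevlex t t"
  by (simp add: degrevlex_def)

lemma degrevlex_trans:
  assumes "degrevlex r s" and "degrevlex s t"
  shows "degrevlex r t"
proof -
  obtain k where k: "lookup r k > lookup s k" "\<And>i. i < k \<Longrightarrow> lookup r i = lookup s i"
    using assms(1) unfolding degrevlex_def by blast
  obtain l where l: "lookup s l > lookup t l" "\<And>i. i < l \<Longrightarrow> lookup s i = lookup t i"
    using assms(2) unfolding degrevlex_def by blast
  have "lookup r (min k l) > lookup t (min k l)"
    using k l by (cases k l rule: linorder_cases) (auto simp: min_def)
  moreover have "\<forall>i<min k l. lookup r i = lookup t i" using k(2) l(2) by simp
  ultimately show ?thesis using assms unfolding degrevlex_def by auto
qed

lemma degrevlex_total:
  assumes "term_degree s = term_degree t" and "s \<noteq> t"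
  shows "degrevlex s t \<or> degrevlex t s"
proof -
  let ?D = "{i. lookup s i \<noteq> lookup t i}"
  have "?D \<noteq> {}" using assms(2) by (auto simp: poly_mapping_eq_iff fun_eq_iff)
  then have "Min ?D \<in> ?D" by (intro Min_in) auto
  moreover have "\<forall>i<Min ?D. lookup s i = lookup t i"
  proof (intro allI impI)
    fix i assume "i < Min ?D"
    then have "i \<notin> ?D" using Min_le[of ?D i] by (meson finite leD)
    then show "lookup s i = lookup t i" by simp
  qed
  ultimately show ?thesis
    using assms(1) unfolding degrevlex_def by (metis (mono_tags) linorder_neqE_nat mem_Collect_eq)
qed

lemma degrevlex_add_right: "degrevlex (s + u) (t + u) \<longleftrightarrow> degrevlex s t"
  by (simp add: degrevlex_def term_degree_add lookup_add)

text \<open>At the first difference \<open>s\<close> has the larger, hence a positive, exponent, so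
  below \<open>mv s\<close> both terms have exponents 0.\<close>

lemma degrevlex_imp_mv_le:
  assumes "degrevlex s t"
  shows "mv s \<le> mv t"
  unfolding le_mv_iff
proof (intro allI impI)
  fix l assume l: "l < mv s"
  obtain k where k: "lookup s k > lookup t k" "\<And>i. i < k \<Longrightarrow> lookup s i = lookup t i"
    using assms unfolding degrevlex_def by blast
  have s: "\<forall>l<mv s. lookup s l = 0" using le_mv_iff by blast
  then have "mv s \<le> k" using k(1) by (metis not_le not_less0)
  then show "lookup t l = 0" using k(2)[of l] s l by auto
qed

lemma finite_term_degree: "finite {t :: 'n::finite pterm. term_degree t = d}"
proof (rule finite_imageD)
  have "lookup t i \<le> term_degree t" for t :: "'n pterm" and i
    unfolding term_degree_def by (rule member_le_sum) auto
  then have "lookup ` {t :: 'n pterm. term_degree t = d} \<subseteq> PiE UNIV (\<lambda>_. {..d})"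
    by auto
  then show "finite (lookup ` {t :: 'n pterm. term_degree t = d})"
    by (rule finite_subset) (intro finite_PiE, auto)
  show "inj_on lookup {t :: 'n pterm. term_degree t = d}"
    by (rule inj_onI) (rule poly_mapping_eqI, simp)
qed

definition drl_le :: "'n::{finite,linorder} pterm \<Rightarrow> 'n pterm \<Rightarrow> bool"
  where "drl_le s t \<longleftrightarrow> degrevlex s t \<or> s = t"

text \<open>Turns degrevlex on the terms of one degree into the order of the natural numbers, where
  the matching argument below applies.\<close>

definition drl_rank :: "'n::{finite,linorder} pterm \<Rightarrow> nat"
  where "drl_rank t = card {s. term_degree s = term_degree t \<and> degrevlex s t}"

lemma drl_rank_less:
  assumes "degrevlex s t"
  shows "drl_rank s < drl_rank t"
proof -
  have "term_degree s = term_degree t" using assms by (simp add: degrevlex_def)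
  then have "{r. term_degree r = term_degree s \<and> degrevlex r s} \<subset>
      {r. term_degree r = term_degree t \<and> degrevlex r t}"
    using assms degrevlex_irrefl[of s] degrevlex_trans[OF _ assms] by auto
  then show ?thesis
    unfolding drl_rank_def
    by (intro psubset_card_mono) (auto intro: finite_subset[OF _ finite_term_degree])
qed

lemma drl_le_iff_rank:
  assumes "term_degree s = term_degree t"
  shows "drl_le s t \<longleftrightarrow> drl_rank s \<le> drl_rank t"
  using degrevlex_total[OF assms] drl_rank_less[of s t] drl_rank_less[of t s]
  unfolding drl_le_def by (metis less_imp_le not_le order_refl)

subsection \<open>Domination as a counting condition\<close>

text \<open>Greedy matching: a largest element of \<open>A\<close> is sent to a largest element of
  \<open>B\<close>, and the rest follows by induction.\<close>

lemma ex_dominating_bij: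
  fixes f :: "'a \<Rightarrow> 'b::linorder"
  assumes "finite A" and "finite B" and "card A = card B"
    and "\<And>a. a \<in> A \<Longrightarrow> card {x\<in>A. f a \<le> f x} \<le> card {y\<in>B. f a \<le> f y}"
  shows "\<exists>\<omega>. bij_betw \<omega> A B \<and> (\<forall>a\<in>A. f a \<le> f (\<omega> a))"
  using assms
proof (induction "card A" arbitrary: A B)
  case 0
  then show ?case by (auto simp: bij_betw_def)
next
  case (Suc n)
  then have "A \<noteq> {}" "B \<noteq> {}" by auto
  have max: "\<exists>c\<in>C. \<forall>x\<in>C. f x \<le> f c" if "finite C" "C \<noteq> {}" for C
  proof -
    have "Max (f ` C) \<in> f ` C" using that by simp
    then obtain c where "c \<in> C" "f c = Max (f ` C)" by (metis imageE)
    then show ?thesis using that(1) by (intro bexI[of _ c]) auto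
  qed
  obtain a where a: "a \<in> A" "\<And>x. x \<in> A \<Longrightarrow> f x \<le> f a"
    using max[OF Suc.prems(1) \<open>A \<noteq> {}\<close>] by blast
  obtain b where b: "b \<in> B" "\<And>y. y \<in> B \<Longrightarrow> f y \<le> f b"
    using max[OF Suc.prems(2) \<open>B \<noteq> {}\<close>] by blast
  have "a \<in> {x\<in>A. f a \<le> f x}" using a(1) by simp
  then have "card {x\<in>A. f a \<le> f x} > 0"
    using Suc.prems(1) by (auto simp: card_gt_0_iff)
  then have "card {y\<in>B. f a \<le> f y} > 0" using Suc.prems(4)[OF a(1)] by simp
  then obtain y where "y \<in> B" "f a \<le> f y" by (auto simp: card_gt_0_iff)
  then have ab: "f a \<le> f b" using b(2) by (meson order_trans)
  have "\<exists>\<omega>. bij_betw \<omega> (A - {a}) (B - {b}) \<and> (\<forall>x\<in>A - {a}. f x \<le> f (\<omega> x))"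
  proof (rule Suc.hyps(1))
    show "n = card (A - {a})" "card (A - {a}) = card (B - {b})"
      using Suc.hyps(2) Suc.prems(3) a(1) b(1) by simp_all
    fix s assume s: "s \<in> A - {a}"
    \<comment> \<open>Both \<open>a\<close> and \<open>b\<close> lie above every remaining
      threshold, so each count drops by exactly one.\<close>
    have "{x\<in>A. f s \<le> f x} = insert a {x\<in>A - {a}. f s \<le> f x}"
      using a s by auto
    moreover have "{y\<in>B. f s \<le> f y} = insert b {y\<in>B - {b}. f s \<le> f y}"
      using a(2)[of s] b s ab by auto
    ultimately show "card {x\<in>A - {a}. f s \<le> f x} \<le> card {y\<in>B - {b}. f s \<le> f y}"
      using Suc.prems(4)[of s] Suc.prems(1,2) s by simp
  qed (use Suc.prems in auto)
  then obtain \<omega> where \<omega>: "bij_betw \<omega> (A - {a}) (B - {b})" "\<And>x. x \<in> A - {a} \<Longrightarrow> f x \<le> f (\<omega> x)"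
    by blast
  let ?\<omega> = "\<lambda>x. if x = a then b else \<omega> x"
  have "bij_betw ?\<omega> (A - {a}) (B - {b})"
    using \<omega>(1) by (subst bij_betw_cong[of _ _ \<omega>]) auto
  then have "bij_betw ?\<omega> (A - {a} \<union> {a}) (B - {b} \<union> {?\<omega> a})"
    by (intro notIn_Un_bij_betw) auto
  moreover have "A - {a} \<union> {a} = A" "B - {b} \<union> {?\<omega> a} = B" using a(1) b(1) by auto
  ultimately show ?case
    using \<omega>(2) ab by (intro exI[of _ "?\<omega>"]) auto
qed

lemma card_le_of_dominating_bij:
  fixes f :: "'a \<Rightarrow> 'b::preorder"
  assumes "finite B" and "bij_betw \<omega> A B" and "\<And>a. a \<in> A \<Longrightarrow> f a \<le> f (\<omega> a)"
  shows "card {x\<in>A. s \<le> f x} \<le> card {y\<in>B. s \<le> f y}"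
proof (rule card_inj_on_le)
  show "inj_on \<omega> {x\<in>A. s \<le> f x}"
    using assms(2) by (auto simp: bij_betw_def inj_on_def)
  show "\<omega> ` {x\<in>A. s \<le> f x} \<subseteq> {y\<in>B. s \<le> f y}"
    using assms(2,3) by (auto simp: bij_betw_def intro: order_trans)
qed (use assms(1) in auto)

section \<open>Spans of terms, monomial ideals and Hilbert functions\<close>

lemma span_term_poly:
  "module.span scalar (term_poly ` A) = {f :: ('n, 'k::field) mpoly. keys f \<subseteq> A}"
proof (intro antisym subsetI)
  have scalar: "lookup (scalar c f) t = c * lookup f t" for c t and f :: "('n, 'k) mpoly"
    by (simp add: scalar_def lookup_Const_mult)
  have "mpoly_vs.subspace {f :: ('n, 'k) mpoly. keys f \<subseteq> A}"
    unfolding mpoly_vs.subspace_def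
    by (auto simp: subset_iff in_keys_iff lookup_add scalar) (metis add.right_neutral)
  moreover have "(term_poly ` A :: ('n, 'k) mpoly set) \<subseteq> {f. keys f \<subseteq> A}" by auto
  ultimately show "f \<in> {f. keys f \<subseteq> A}" if "f \<in> mpoly_vs.span (term_poly ` A)"
    for f :: "('n, 'k) mpoly"
    using that mpoly_vs.span_minimal by blast
  fix f :: "('n, 'k) mpoly" assume f: "f \<in> {f. keys f \<subseteq> A}"
  have "f = (\<Sum>t\<in>keys f. scalar (lookup f t) (term_poly t))"
    by (rule poly_mapping_eqI)
      (simp add: lookup_sum scalar_def lookup_Const_mult_term_poly in_keys_iff)
  moreover have "(\<Sum>t\<in>keys f. scalar (lookup f t) (term_poly t)) \<in> mpoly_vs.span (term_poly ` A)"
    using f by (intro mpoly_vs.span_sum mpoly_vs.span_scale mpoly_vs.span_base) auto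
  ultimately show "f \<in> mpoly_vs.span (term_poly ` A)" by simp
qed

text \<open>Shows that the sets of terms quantified in \<open>dominated\<close> are determined by
  the two subspaces.\<close>

lemma span_term_poly_inj:
  assumes "module.span scalar (term_poly ` A) =
    (module.span scalar (term_poly ` B) :: ('n, 'k::field) mpoly set)"
  shows "A = B"
proof -
  have "t \<in> A \<longleftrightarrow> t \<in> B" for t
    using assms unfolding span_term_poly set_eq_iff by (auto dest!: spec[of _ "term_poly t"])
  then show ?thesis by blast
qed

lemma dim_span_term_poly:
  "vector_space.dim scalar (module.span scalar (term_poly ` A) :: ('n, 'k::field) mpoly set) = card A"
proof -
  have inj: "inj (term_poly :: _ \<Rightarrow> ('n, 'k) mpoly)"
    by (rule injI) (metis keys_term_poly singleton_inject)
  have "mpoly_vs.independent (term_poly ` A :: ('n, 'k) mpoly set)"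
  proof
    assume "mpoly_vs.dependent (term_poly ` A :: ('n, 'k) mpoly set)"
    then obtain t where "t \<in> A"
      "term_poly t \<in> mpoly_vs.span (term_poly ` A - {term_poly t :: ('n, 'k) mpoly})"
      unfolding mpoly_vs.dependent_def by blast
    moreover have "term_poly ` A - {term_poly t :: ('n, 'k) mpoly} = term_poly ` (A - {t})"
      using inj by (auto simp: inj_def)
    ultimately show False by (simp add: span_term_poly)
  qed
  then have "mpoly_vs.dim (mpoly_vs.span (term_poly ` A :: ('n, 'k) mpoly set)) =
      card (term_poly ` A :: ('n, 'k) mpoly set)"
    by (rule mpoly_vs.dim_span_eq_card_independent)
  then show ?thesis
    by (simp add: card_image[OF inj_on_subset[OF inj]])
qed

definition monomial_ideal :: "('n, 'k::field) mpoly set \<Rightarrow> bool"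
  where "monomial_ideal I \<longleftrightarrow> is_ideal I \<and> (\<forall>f\<in>I. \<forall>t\<in>keys f. term_poly t \<in> I)"

definition ideal_terms :: "('n::finite, 'k::field) mpoly set \<Rightarrow> nat \<Rightarrow> 'n pterm set"
  where "ideal_terms I d = {t. term_degree t = d \<and> term_poly t \<in> I}"

lemma finite_ideal_terms [simp]: "finite (ideal_terms I d)"
  unfolding ideal_terms_def by (rule finite_subset[OF _ finite_term_degree[of d]]) auto

lemma component_eq_span:
  fixes I :: "('n::finite, 'k::field) mpoly set"
  assumes "monomial_ideal I"
  shows "component I (int d) = module.span scalar (term_poly ` ideal_terms I d)"
  unfolding span_term_poly
proof (intro antisym subsetI)
  fix f assume "f \<in> component I (int d)"
  then show "f \<in> {f. keys f \<subseteq> ideal_terms I d}"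
    using assms by (auto simp: monomial_ideal_def component_def homogeneous_def ideal_terms_def)
next
  fix f :: "('n, 'k) mpoly" assume f: "f \<in> {f. keys f \<subseteq> ideal_terms I d}"
  have "f = (\<Sum>t\<in>keys f. Const (lookup f t) * term_poly t)"
    by (rule poly_mapping_eqI) (simp add: lookup_sum lookup_Const_mult_term_poly in_keys_iff)
  moreover have "(\<Sum>t\<in>keys f. Const (lookup f t) * term_poly t) \<in> I"
    using f assms by (intro ideal_sum ideal_mult) (auto simp: ideal_terms_def monomial_ideal_def)
  ultimately show "f \<in> component I (int d)"
    using f by (auto simp: component_def homogeneous_def ideal_terms_def)
qed

lemma hilbert_function_eq:
  fixes I :: "('n::finite, 'k::field) mpoly set"
  assumes "monomial_ideal I"
  shows "hilbert_function I d = card {t :: 'n pterm. term_degree t = d} - card (ideal_terms I d)"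
proof -
  have "monomial_ideal (UNIV :: ('n, 'k) mpoly set)"
    by (simp add: monomial_ideal_def is_ideal_def)
  then have "component (UNIV :: ('n, 'k) mpoly set) (int d) =
      module.span scalar (term_poly ` ideal_terms (UNIV :: ('n, 'k) mpoly set) d)"
    by (rule component_eq_span)
  then show ?thesis
    unfolding hilbert_function_def component_eq_span[OF assms]
    by (simp only: dim_span_term_poly) (simp add: ideal_terms_def)
qed

lemma dominated_iff_card:
  fixes I J :: "('n::{finite,linorder}, 'k::field) mpoly set"
  assumes "monomial_ideal J" and "monomial_ideal I"
  shows "dominated degrevlex (component J (int d)) (component I (int d)) \<longleftrightarrow>
    card (ideal_terms J d) = card (ideal_terms I d) \<and>
    (\<forall>s. term_degree s = d \<longrightarrow>
      card {t \<in> ideal_terms J d. drl_le s t} \<le> card {t \<in> ideal_terms I d. drl_le s t})"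
    (is "?L \<longleftrightarrow> ?R")
proof -
  have deg: "term_degree t = d" if "t \<in> ideal_terms K d" for t and K :: "('n, 'k) mpoly set"
    using that by (simp add: ideal_terms_def)
  have eq: "{t \<in> ideal_terms K d. drl_le s t} = {t \<in> ideal_terms K d. drl_rank s \<le> drl_rank t}"
    if "term_degree s = d" for s and K :: "('n, 'k) mpoly set"
  proof -
    have "drl_le s t \<longleftrightarrow> drl_rank s \<le> drl_rank t" if "t \<in> ideal_terms K d" for t
      using deg[OF that] \<open>term_degree s = d\<close> by (intro drl_le_iff_rank) simp
    then show ?thesis by blast
  qed
  show ?thesis
  proof
    assume ?L
    then obtain A B \<omega> where AB: "component J (int d) = module.span scalar (term_poly ` A)"
      "component I (int d) = module.span scalar (term_poly ` B)"
      and \<omega>: "bij_betw \<omega> A B" "\<forall>a\<in>A. degrevlex a (\<omega> a) \<or> a = \<omega> a"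
      unfolding dominated_def by blast
    have A: "A = ideal_terms J d" and B: "B = ideal_terms I d"
      using AB component_eq_span[OF assms(1)] component_eq_span[OF assms(2)]
      by (auto intro!: span_term_poly_inj)
    have "drl_rank a \<le> drl_rank (\<omega> a)" if "a \<in> A" for a
      using \<omega>(2) that drl_rank_less[of a "\<omega> a"] by fastforce
    from card_le_of_dominating_bij[where f = drl_rank, OF _ \<omega>(1) this]
    show ?R
      using bij_betw_same_card[OF \<omega>(1)] by (simp add: A B eq)
  next
    assume R: ?R
    have "\<exists>\<omega>. bij_betw \<omega> (ideal_terms J d) (ideal_terms I d) \<and>
        (\<forall>a\<in>ideal_terms J d. drl_rank a \<le> drl_rank (\<omega> a))"
      by (rule ex_dominating_bij) (use R deg eq in auto)
    then obtain \<omega> where \<omega>: "bij_betw \<omega> (ideal_terms J d) (ideal_terms I d)"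
      "\<And>a. a \<in> ideal_terms J d \<Longrightarrow> drl_rank a \<le> drl_rank (\<omega> a)" by blast
    have "degrevlex a (\<omega> a) \<or> a = \<omega> a" if a: "a \<in> ideal_terms J d" for a
    proof -
      have "\<omega> a \<in> ideal_terms I d" using \<omega>(1) a by (auto simp: bij_betw_def)
      then have "term_degree a = term_degree (\<omega> a)" using deg a by metis
      from drl_le_iff_rank[OF this] \<omega>(2)[OF a] show ?thesis by (simp add: drl_le_def)
    qed
    with \<omega>(1) show ?L
      unfolding dominated_def component_eq_span[OF assms(1)] component_eq_span[OF assms(2)]
      by (intro exI[of _ d] exI[of _ "ideal_terms J d"] exI[of _ "ideal_terms I d"])
        (auto simp: deg)
  qed
qed

subsection \<open>Counting by the least variable\<close>

text \<open>This makes \<open>u = t x\<^sub>j\<close> with \<open>t \<in> I\<close> and \<open>j \<le> mv t\<close> unique for each \<open>u \<in> I\<close> of degree above \<open>m\<close>.\<close>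

definition stable_from :: "nat \<Rightarrow> ('n::{finite,linorder}, 'k::field) mpoly set \<Rightarrow> bool"
  where "stable_from m I \<longleftrightarrow> (\<forall>t j. m \<le> term_degree t \<longrightarrow> j \<le> mv t \<longrightarrow>
    (term_poly (t + var_term j) \<in> I \<longleftrightarrow> term_poly t \<in> I))"

lemma stable_from_borel_fixed:
  fixes I :: "('n::{finite,linorder}, 'k::field) mpoly set"
  assumes "infinite (UNIV :: 'k set)" and "is_ideal I" and "borel_fixed I"
    and "m_regular (int m) I"
  shows "stable_from m I"
  unfolding stable_from_def le_mv_iff
  using borel_fixed_regular_quotient[OF assms] ideal_term_poly_add[OF assms(2)] by auto

definition num_mv :: "('n::{finite,linorder}, 'k::field) mpoly set \<Rightarrow> nat \<Rightarrow> 'n \<Rightarrow> nat"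
  where "num_mv I d j = card {t \<in> ideal_terms I d. mv t = j}"

lemma sum_num_mv: "(\<Sum>j\<in>C. num_mv I d j) = card {t \<in> ideal_terms I d. mv t \<in> C}"
proof -
  have "{t \<in> ideal_terms I d. mv t \<in> C} = (\<Union>j\<in>C. {t \<in> ideal_terms I d. mv t = j})" by auto
  also have "card \<dots> = (\<Sum>j\<in>C. num_mv I d j)"
    unfolding num_mv_def
    by (rule card_UN_disjoint) (auto intro: finite_subset[OF subset_UNIV])
  finally show ?thesis ..
qed

lemma card_ideal_terms: "card (ideal_terms I d) = (\<Sum>j\<in>UNIV. num_mv I d j)"
  by (simp add: sum_num_mv)

text \<open>Multiplication by \<open>x\<^sub>j\<close> is inverted by division by the least
  variable. The predicate \<open>P\<close> serves both the plain count and the count above a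
  degrevlex threshold.\<close>

lemma ideal_terms_Suc:
  assumes "stable_from m I" and "m \<le> d"
  shows "{u \<in> ideal_terms I (Suc d). mv u = j \<and> P u} =
    (\<lambda>t. t + var_term j) ` {t \<in> ideal_terms I d. j \<le> mv t \<and> P (t + var_term j)}" (is "?L = ?R")
proof (intro antisym subsetI)
  fix u assume u: "u \<in> ?L"
  then have "term_degree u = Suc d" and j: "mv u = j" by (auto simp: ideal_terms_def)
  note t = term_degree_diff_mv[OF this(1), unfolded j]
  have "term_poly (u - var_term j) \<in> I"
    using assms(1)[unfolded stable_from_def, rule_format, of "u - var_term j" j] t \<open>m \<le> d\<close> u
    by (simp add: ideal_terms_def)
  then show "u \<in> ?R"
    using t u by (intro image_eqI[of _ _ "u - var_term j"]) (auto simp: ideal_terms_def)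
next
  fix u assume "u \<in> ?R"
  then obtain t where "u = t + var_term j" "t \<in> ideal_terms I d" "j \<le> mv t" "P u" by blast
  then show "u \<in> ?L"
    using assms by (auto simp: ideal_terms_def stable_from_def mv_add_var_term term_degree_add)
qed

lemma card_image_add_var_term:
  "card ((\<lambda>t. t + var_term j) ` A) = card (A :: 'n pterm set)"
  by (rule card_image) (simp add: inj_on_def)

lemma num_mv_Suc:
  assumes "stable_from m I" and "m \<le> d"
  shows "num_mv I (Suc d) j = (\<Sum>i\<in>{j..}. num_mv I d i)"
  using ideal_terms_Suc[OF assms, of j "\<lambda>_. True"]
  by (simp add: num_mv_def[of I "Suc d"] card_image_add_var_term sum_num_mv)

text \<open>Induction upwards on \<open>j\<close>: subtracting the counts below \<open>j\<close>
  from the total leaves the tail sum from \<open>j\<close> on, which is the count for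
  \<open>j\<close> one degree higher.\<close>

lemma eventually_num_mv_eq:
  fixes I J :: "('n::{finite,linorder}, 'k::field) mpoly set"
  assumes "stable_from m I" and "stable_from m J"
    and ev: "\<forall>\<^sub>F d in sequentially. card (ideal_terms J d) = card (ideal_terms I d)"
  shows "\<forall>\<^sub>F d in sequentially. num_mv J d j = num_mv I d j"
proof (induction "card {..<j}" arbitrary: j rule: less_induct)
  case less
  have "\<forall>i\<in>{..<j}. \<forall>\<^sub>F d in sequentially. num_mv J d i = num_mv I d i"
  proof
    fix i assume "i \<in> {..<j}"
    then have "card {..<i} < card {..<j}"
      by (intro psubset_card_mono) auto
    then show "\<forall>\<^sub>F d in sequentially. num_mv J d i = num_mv I d i" by (rule less.hyps)
  qed
  then have "\<forall>\<^sub>F d in sequentially. \<forall>i\<in>{..<j}. num_mv J d i = num_mv I d i"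
    by (intro eventually_ball_finite) auto
  then have "\<forall>\<^sub>F d in sequentially. num_mv J (Suc d) j = num_mv I (Suc d) j"
    using ev eventually_ge_at_top[of m]
  proof eventually_elim
    case (elim d)
    have split: "card (ideal_terms K d) = (\<Sum>i\<in>{..<j}. num_mv K d i) + (\<Sum>i\<in>{j..}. num_mv K d i)"
      for K :: "('n, 'k) mpoly set"
    proof -
      have "UNIV = {..<j} \<union> {j..}" by auto
      then show ?thesis
        unfolding card_ideal_terms
        by (subst sum.union_disjoint[symmetric]) (auto intro: finite_subset[OF subset_UNIV])
    qed
    have "(\<Sum>i\<in>{..<j}. num_mv J d i) = (\<Sum>i\<in>{..<j}. num_mv I d i)"
      using elim(1) by (intro sum.cong) auto
    then have "(\<Sum>i\<in>{j..}. num_mv J d i) = (\<Sum>i\<in>{j..}. num_mv I d i)"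
      using elim(2) split[of I] split[of J] by linarith
    then show ?case
      using num_mv_Suc[OF assms(1) elim(3)] num_mv_Suc[OF assms(2) elim(3)] by simp
  qed
  then show ?case by (simp add: eventually_sequentially_Suc[of "\<lambda>d. num_mv J d j = num_mv I d j"])
qed

text \<open>The recursion is unitriangular: the tail sums in degree \<open>d\<close> are the counts
  in degree \<open>d + 1\<close>, and consecutive tails recover the single counts. So equality
  descends from large degrees to \<open>m\<close>.\<close>

lemma num_mv_eq:
  fixes I J :: "('n::{finite,linorder}, 'k::field) mpoly set"
  assumes "stable_from m I" and "stable_from m J"
    and "\<forall>\<^sub>F d in sequentially. card (ideal_terms J d) = card (ideal_terms I d)"
    and "m \<le> d"
  shows "num_mv J d = num_mv I d"
proof -
  have step: "num_mv J d = num_mv I d" if eq: "num_mv J (Suc d) = num_mv I (Suc d)" and "m \<le> d" for d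
  proof
    have tail: "(\<Sum>i\<in>{j..}. num_mv J d i) = (\<Sum>i\<in>{j..}. num_mv I d i)" for j
      using num_mv_Suc[OF assms(1) \<open>m \<le> d\<close>] num_mv_Suc[OF assms(2) \<open>m \<le> d\<close>] eq by metis
    show "num_mv J d j = num_mv I d j" for j
    proof (induction "card {j<..}" arbitrary: j rule: less_induct)
      case less
      have "(\<Sum>i\<in>{j<..}. num_mv J d i) = (\<Sum>i\<in>{j<..}. num_mv I d i)"
      proof (rule sum.cong[OF refl])
        fix i assume "i \<in> {j<..}"
        then have "card {i<..} < card {j<..}"
          by (intro psubset_card_mono) auto
        then show "num_mv J d i = num_mv I d i" by (rule less.hyps)
      qed
      moreover have "{j..} = insert j {j<..}" by auto
      ultimately show ?case using tail[of j] by simp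
    qed
  qed
  have "\<forall>\<^sub>F d in sequentially. \<forall>j\<in>UNIV. num_mv J d j = num_mv I d j"
    using eventually_num_mv_eq[OF assms(1-3)] by (intro eventually_ball_finite) auto
  then obtain N where N: "\<And>d. N \<le> d \<Longrightarrow> num_mv J d = num_mv I d"
    by (auto simp: eventually_sequentially)
  have "num_mv J (d + k) = num_mv I (d + k) \<Longrightarrow> num_mv J d = num_mv I d" for k
  proof (induction k)
    case (Suc k)
    then show ?case using step[of "d + k"] \<open>m \<le> d\<close> by simp
  qed simp
  then show ?thesis using N[of "d + N"] by simp
qed

text \<open>A term with greater least variable than \<open>u\<close> is automatically above
  \<open>u\<close>; one with the same least variable is compared after dividing both by it.\<close>

lemma card_ideal_terms_ge:
  assumes "stable_from m I" and "m \<le> d" and u: "term_degree u = Suc d"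
  shows "card {t \<in> ideal_terms I (Suc d). drl_le u t} =
    (\<Sum>i\<in>{mv u<..}. num_mv I (Suc d) i) + card {t \<in> ideal_terms I d. drl_le (u - var_term (mv u)) t}"
proof -
  define j where "j = mv u"
  define s where "s = u - var_term j"
  have s: "s + var_term j = u" "j \<le> mv s"
    using term_degree_diff_mv[OF u] by (simp_all add: s_def j_def)
  have greater: "drl_le u t" if "t \<in> ideal_terms I (Suc d)" "j < mv t" for t
  proof -
    have "term_degree u = term_degree t" "u \<noteq> t" using that u by (auto simp: ideal_terms_def j_def)
    moreover have "\<not> degrevlex t u" using degrevlex_imp_mv_le[of t u] that(2) by (auto simp: j_def)
    ultimately show ?thesis using degrevlex_total by (auto simp: drl_le_def)
  qed
  have "drl_le u t \<Longrightarrow> j \<le> mv t" for t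
    using degrevlex_imp_mv_le[of u t] by (auto simp: drl_le_def j_def)
  then have "{t \<in> ideal_terms I (Suc d). drl_le u t} = {t \<in> ideal_terms I (Suc d). mv t \<in> {j<..}} \<union>
      {t \<in> ideal_terms I (Suc d). mv t = j \<and> drl_le u t}" (is "_ = ?A \<union> ?B")
    using greater by force
  then have "card {t \<in> ideal_terms I (Suc d). drl_le u t} = card ?A + card ?B"
    by (simp only:) (rule card_Un_disjoint, auto)
  also have "card ?A = (\<Sum>i\<in>{j<..}. num_mv I (Suc d) i)" by (rule sum_num_mv[symmetric])
  also have "card ?B = card {t \<in> ideal_terms I d. j \<le> mv t \<and> drl_le u (t + var_term j)}"
    unfolding ideal_terms_Suc[OF assms(1,2)] by (rule card_image_add_var_term)
  also have "{t \<in> ideal_terms I d. j \<le> mv t \<and> drl_le u (t + var_term j)} =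
      {t \<in> ideal_terms I d. drl_le s t}"
  proof -
    have "drl_le u (t + var_term j) \<longleftrightarrow> drl_le s t" for t
      by (simp add: drl_le_def degrevlex_add_right flip: s(1))
    moreover have "j \<le> mv t" if "drl_le s t" for t
      using that s(2) degrevlex_imp_mv_le[of s t] by (auto simp: drl_le_def)
    ultimately show ?thesis by auto
  qed
  finally show ?thesis by (simp add: j_def s_def)
qed

theorem proposition5p10:
  fixes I J :: "('n::{finite,linorder}, 'k::field) mpoly set"
    and m :: int and p :: "rat poly"
  assumes "infinite (UNIV :: 'k set)"
    and "is_ideal J" and "borel_fixed J" and "m_regular m J"
    and "is_ideal I" and "borel_fixed I" and "m_regular m I"
    and "is_hilbert_polynomial J p" and "is_hilbert_polynomial I p"
  shows "dominated degrevlex (component J m) (component I m) \<longleftrightarrow>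
    dominated degrevlex (component J (m + 1)) (component I (m + 1))"
proof (cases "m < 0")
  case True
  have "I = {0}" "J = {0}"
    using assms(4,7) True by (simp_all only: m_regular_negative)
  \<comment> \<open>All four components are zero, and the zero space is spanned by the empty set of
    terms.\<close>
  moreover have "dominated degrevlex {0} ({0} :: ('n, 'k) mpoly set)"
    unfolding dominated_def
    by (rule exI[of _ 0], rule exI[of _ "{}"], rule exI[of _ "{}"])
      (auto simp: mpoly_vs.span_empty bij_betw_def)
  ultimately show ?thesis by (simp add: component_def cong: conj_cong)
next
  case False
  then obtain d where m: "m = int d" by (metis nonneg_int_cases not_le)
  have J: "monomial_ideal J" and I: "monomial_ideal I"
    using borel_fixed_monomial assms unfolding monomial_ideal_def by blast+
  have stable: "stable_from d I" "stable_from d J"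
    using stable_from_borel_fixed assms unfolding m by blast+
  have "\<forall>\<^sub>F t in sequentially. card (ideal_terms J t) = card (ideal_terms I t)"
    using assms(8,9) unfolding is_hilbert_polynomial_def
  proof eventually_elim
    case (elim t)
    then have "of_nat (hilbert_function J t) = (of_nat (hilbert_function I t) :: rat)" by simp
    then have "hilbert_function J t = hilbert_function I t" by simp
    \<comment> \<open>The Hilbert function is a truncated difference, so this bound is needed for
      cancellation.\<close>
    moreover have "card (ideal_terms K t) \<le> card {s :: 'n pterm. term_degree s = t}"
      for K :: "('n, 'k) mpoly set"
      by (rule card_mono) (auto simp: finite_term_degree ideal_terms_def)
    ultimately show ?case
      using hilbert_function_eq[OF J, of t] hilbert_function_eq[OF I, of t]
      by (metis diff_diff_cancel)
  qed
  note num = num_mv_eq[OF stable this]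
  have card: "card (ideal_terms J e) = card (ideal_terms I e)" if "d \<le> e" for e
    using num[OF that] by (simp add: card_ideal_terms)
  let ?n = "\<lambda>K d s. card {t \<in> ideal_terms K d. drl_le s t}"
  \<comment> \<open>The summands for greater least variables agree for \<open>I\<close> and
    \<open>J\<close> and cancel.\<close>
  have iff: "?n J (Suc d) u \<le> ?n I (Suc d) u \<longleftrightarrow>
      ?n J d (u - var_term (mv u)) \<le> ?n I d (u - var_term (mv u))" if "term_degree u = Suc d" for u
    using card_ideal_terms_ge[OF stable(1) order_refl that]
      card_ideal_terms_ge[OF stable(2) order_refl that] num[of "Suc d"] by simp
  have "(\<forall>u. term_degree u = Suc d \<longrightarrow> ?n J (Suc d) u \<le> ?n I (Suc d) u) \<longleftrightarrow>
      (\<forall>s. term_degree s = d \<longrightarrow> ?n J d s \<le> ?n I d s)" (is "?L \<longleftrightarrow> ?R")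
  proof
    assume L: ?L
    show ?R
    proof (intro allI impI)
      fix s :: "'n pterm" assume s: "term_degree s = d"
      \<comment> \<open>Multiplying by the smallest variable exhibits every \<open>s\<close> as the
        quotient of some \<open>u\<close> by its least variable.\<close>
      let ?u = "s + var_term (Min UNIV)"
      have "Min UNIV \<le> mv s" by simp
      then have "mv ?u = Min UNIV" by (rule mv_add_var_term)
      moreover have "term_degree ?u = Suc d" using s by (simp add: term_degree_add)
      ultimately show "?n J d s \<le> ?n I d s"
        using L iff[of ?u] by simp
    qed
  next
    assume R: ?R
    show ?L
    proof (intro allI impI)
      fix u :: "'n pterm" assume u: "term_degree u = Suc d"
      show "?n J (Suc d) u \<le> ?n I (Suc d) u"
        using R iff[OF u] term_degree_diff_mv(2)[OF u] by simp
    qed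
  qed
  then show ?thesis
    using card[of d] card[of "Suc d"]
      dominated_iff_card[OF J I, of d]
      dominated_iff_card[OF J I, of "Suc d"]
    by (simp add: m add.commute)
qed

end
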